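(* Let $k\ge 0$, $\theta\in\{0,1,-1\}$, $\gamma>0$, $T>0$, and let $\zeta=\{\zeta_F\}_{F\in\mathcal F_h}$ be non-negative constants. Let $c_h\in\{c_h^1,c_h^2\}$. (i) (Schemes dG1 and dG2.) Assume $\zeta_F\ge \tfrac12|1-\theta|$ for all boundary faces $F\in\mathcal F_h^{\partial}$. Let $(\boldsymbol u_h(t),P_h(t))\in \boldsymbol V_h\times Q_h$ satisfy, for every $t\in(0,T]$, $$(\partial_t\boldsymbol u_h,\boldsymbol v_h)+c_h(\boldsymbol u_h;\boldsymbol u_h,\boldsymbol v_h)-b_h(\boldsymbol v_h,P_h)+d_h(\boldsymbol u_h,\boldsymbol v_h)=0\quad\forall \boldsymbol v_h\in\boldsymbol V_h,\qquad b_h(\boldsymbol u_h,q_h)=0\quad\forall q_h\in Q_h.$$ Then $\|\boldsymbol u_h(t)\|_{L^2(\Omega)}\le\|\boldsymbol u_h(0)\|_{L^2(\Omega)}$ for all $0\le t\le T$. (ii) (Scheme Hdiv.) Let $\zeta_F\ge 0$ be arbitrary, and let $(\boldsymbol u_h(t),P_h(t))\in \boldsymbol V_h^{\mathrm{div}}\times Q_h$ satisfy, for every $t\in(0,T]$, $$(\partial_t\boldsymbol u_h,\boldsymbol v_h)+c_h(\boldsymbol u_h;\boldsymbol u_h,\boldsymbol v_h)-(\nabla\cdot\boldsymbol v_h,P_h)=0\quad\forall \boldsymbol v_h\in\boldsymbol V_h^{\mathrm{div}},\qquad (\nabla\cdot\boldsymbol u_h,q_h)=0\quad\forall q_h\in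 Q_h.$$ Then $\|\boldsymbol u_h(t)\|_{L^2(\Omega)}\le\|\boldsymbol u_h(0)\|_{L^2(\Omega)}$ for all $0\le t\le T$.
   Context: **Mesh.** $\mathcal T_h$ is a conforming shape-regular simplicial mesh of a bounded polyhedral domain $\Omega\subset\mathbb R^d$, $d\in\{2,3\}$; $\mathcal F_h$ is its set of faces, $\mathcal F_h^i$ the interior faces, $\mathcal F_h^\partial$ the boundary faces, $h_F$ the diameter of $F$. Each $F\in\mathcal F_h^i$ carries a fixed unit normal $\boldsymbol n_F$ pointing from one adjacent element $K^+$ to the other, $K^-$; for $F\in\mathcal F_h^\partial$, $\boldsymbol n_F$ is the outward unit normal to $\partial\Omega$. $\boldsymbol n|_F:=\boldsymbol n_F$. For a scalar- or vector-valued piecewise smooth $\phi$: on interior faces $[\![\phi]\!]=\phi|_{K^+}-\phi|_{K^-}$ and $\{\!\{\phi\}\!\}=\frac12(\phi|_{K^+}+\phi|_{K^-})$; on a boundary face of $K$, $[\![\phi]\!]=\{\!\{\phi\}\!\}=\phi|_K$. $(\cdot,\cdot)$ is the $L^2(\Omega)$ inner product, $\langle\cdot,\cdot\rangle_F$ the $L^2(F)$ inner product, $\langle\cdot,\cdot\rangle_{\mathcal F_h}=\sum_{F\in\mathcal F_h}\langle\cdot,\cdot\rangle_F$, $\langle\cdot,\cdot\rangle_{\mathcal F_h^i}=\sum_{F\in\mathcal F_h^i}\langle\cdot,\cdot\rangle_F$. $\nabla_h$, $\nabla_h\cdot$ are the elementwise gradient and divergence; $\boldsymbol\beta\cdot\nabla_h\boldsymbol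 v=(\boldsymbol\beta\cdot\nabla_h)\boldsymbol v$, i.e. $(\boldsymbol\beta\cdot\nabla_h\boldsymbol v)_i=\sum_j\beta_j\partial_jv_i$. **Spaces.** With $\mathcal P_j(K)$ the polynomials of degree at most $j$ on $K$: $\boldsymbol V_h=\{\boldsymbol v\in[L^2(\Omega)]^d:\boldsymbol v|_K\in[\mathcal P_{k+1}(K)]^d\ \forall K\in\mathcal T_h\}$; $Q_h=\{q\in L^2(\Omega):\int_\Omega q=0,\ q|_K\in\mathcal P_k(K)\ \forall K\in\mathcal T_h\}$; $\boldsymbol V_h^{\mathrm{div}}=\{\boldsymbol v\in H(\mathrm{div};\Omega):\boldsymbol v|_K\in\boldsymbol{\mathcal Q}_k(K)\ \forall K,\ \boldsymbol v\cdot\boldsymbol n|_{\partial\Omega}=0\}$, where either $\boldsymbol{\mathcal Q}_k(K)=[\mathcal P_k(K)]^d+\mathcal P_k(K)\boldsymbol x$ for all $K$ (Raviart–Thomas) or $\boldsymbol{\mathcal Q}_k(K)=[\mathcal P_{k+1}(K)]^d$ for all $K$ (Brezzi–Douglas–Marini). **Forms.** $$b_h(\boldsymbol v,q)=(\nabla_h\cdot\boldsymbol v,q)-\langle[\![\boldsymbol v]\!]\cdot\boldsymbol n,\{\!\{q\}\!\}\rangle_{\mathcal F_h},$$ $$d_h(\boldsymbol u,\boldsymbol v)=\gamma\Big(\sum_{F\in\mathcal F_h}h_F^{-1}\langle[\![\boldsymbol u]\!]\cdot\boldsymbol n_F,[\![\boldsymbol v]\!]\cdot\boldsymbol n_F\rangle_F+(\nabla_h\cdot\boldsymbol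 u,\nabla_h\cdot\boldsymbol v)\Big),$$ $$\begin{aligned}c_h^1(\boldsymbol u;\boldsymbol u,\boldsymbol v)=&(\boldsymbol u\cdot\nabla_h\boldsymbol u,\boldsymbol v)+\tfrac12((\nabla_h\cdot\boldsymbol u)\boldsymbol u,\boldsymbol v)-\langle(\{\!\{\boldsymbol u\}\!\}\cdot\boldsymbol n)[\![\boldsymbol u]\!],\{\!\{\boldsymbol v\}\!\}\rangle_{\mathcal F_h^i}-\tfrac12\langle[\![\boldsymbol u]\!]\cdot\boldsymbol n,\{\!\{\boldsymbol u\cdot\boldsymbol v\}\!\}\rangle_{\mathcal F_h^i}\\&+\langle\zeta|\{\!\{\boldsymbol u\}\!\}\cdot\boldsymbol n|[\![\boldsymbol u]\!],[\![\boldsymbol v]\!]\rangle_{\mathcal F_h}+\theta\langle(\{\!\{\boldsymbol v\}\!\}\cdot\boldsymbol n)[\![\boldsymbol u]\!],\{\!\{\boldsymbol u\}\!\}\rangle_{\mathcal F_h^i}+\tfrac\theta2\langle[\![\boldsymbol v]\!]\cdot\boldsymbol n,\{\!\{\boldsymbol u\cdot\boldsymbol u\}\!\}\rangle_{\mathcal F_h^i}\\&-\theta(\boldsymbol v\cdot\nabla_h\boldsymbol u,\boldsymbol u)-\tfrac\theta2((\nabla_h\cdot\boldsymbol v)\boldsymbol u,\boldsymbol u),\end{aligned}$$ $$\begin{aligned}c_h^2(\boldsymbol u;\boldsymbol u,\boldsymbol v)=&(\boldsymbol u\cdot\nabla_h\boldsymbol u,\boldsymbol v)+\tfrac{1-\theta}2((\nabla_h\cdot\boldsymbol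 u)\boldsymbol u,\boldsymbol v)-\langle(\{\!\{\boldsymbol u\}\!\}\cdot\boldsymbol n)[\![\boldsymbol u]\!],\{\!\{\boldsymbol v\}\!\}\rangle_{\mathcal F_h^i}-\tfrac{1-\theta}2\langle[\![\boldsymbol u]\!]\cdot\boldsymbol n,\{\!\{\boldsymbol u\cdot\boldsymbol v\}\!\}\rangle_{\mathcal F_h^i}\\&+\langle\zeta|\{\!\{\boldsymbol u\}\!\}\cdot\boldsymbol n|[\![\boldsymbol u]\!],[\![\boldsymbol v]\!]\rangle_{\mathcal F_h}+\theta\langle(\{\!\{\boldsymbol v\}\!\}\cdot\boldsymbol n)[\![\boldsymbol u]\!],\{\!\{\boldsymbol u\}\!\}\rangle_{\mathcal F_h^i}-\theta(\boldsymbol v\cdot\nabla_h\boldsymbol u,\boldsymbol u).\end{aligned}$$ Here $\zeta|_F=\zeta_F$. Scheme dG1 uses $c_h=c_h^1$, scheme dG2 uses $c_h=c_h^2$; Hdiv uses either. **Regularity convention.** A semi-discrete solution means that $t\mapsto\boldsymbol u_h(t)$ is continuous on $[0,T]$ and differentiable on $(0,T]$ as a map into the finite-dimensional velocity space. *)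

theory Defs
  imports "HOL-Analysis.Analysis"
begin

section \<open>Meshes\<close>

text \<open>Open, connected and bounded, with closure a finite union of polytopes. The condition
  \<open>interior (closure \<Omega>) = \<Omega>\<close> excludes slits; a Lipschitz boundary is not required.\<close>

definition polyhedral_domain :: "(real^'n) set \<Rightarrow> bool" where
  "polyhedral_domain \<Omega> \<longleftrightarrow>
     open \<Omega> \<and> connected \<Omega> \<and> bounded \<Omega> \<and> \<Omega> \<noteq> {} \<and> interior (closure \<Omega>) = \<Omega> \<and>
     (\<exists>\<P>. finite \<P> \<and> (\<forall>P\<in>\<P>. polytope P) \<and> closure \<Omega> = \<Union>\<P>)"

text \<open>The vector \<open>\<nu>\<close> is the unit normal to the facet \<open>F\<close> of the convex set \<open>K\<close>, exterior to \<open>K\<close>.\<close>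

definition outward_normal :: "(real^'n) set \<Rightarrow> (real^'n) set \<Rightarrow> real^'n \<Rightarrow> bool" where
  "outward_normal K F \<nu> \<longleftrightarrow>
     norm \<nu> = 1 \<and> (\<exists>c. (\<forall>x\<in>K. \<nu> \<bullet> x \<le> c) \<and> F = K \<inter> {x. \<nu> \<bullet> x = c})"

definition inradius :: "(real^'n) set \<Rightarrow> real" where
  "inradius K = Sup {r. 0 \<le> r \<and> (\<exists>x. cball x r \<subseteq> K)}"

definition shape_regular :: "real \<Rightarrow> (real^'n) set set \<Rightarrow> bool" where
  "shape_regular \<kappa> \<T> \<longleftrightarrow> (\<forall>K\<in>\<T>. diameter K \<le> \<kappa> * inradius K)"

record ('n::finite) mesh =
  region :: "(real^'n) set"
  elems :: "(real^'n) set set"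
  nrm :: "(real^'n) set \<Rightarrow> real^'n"

definition faces :: "('n::finite) mesh \<Rightarrow> (real^'n) set set" where
  "faces M = {F. \<exists>K\<in>elems M. F facet_of K}"

definition interior_faces :: "('n::finite) mesh \<Rightarrow> (real^'n) set set" where
  "interior_faces M =
     {F. \<exists>K\<in>elems M. \<exists>K'\<in>elems M. K \<noteq> K' \<and> F facet_of K \<and> F facet_of K'}"

definition boundary_faces :: "('n::finite) mesh \<Rightarrow> (real^'n) set set" where
  "boundary_faces M = {F \<in> faces M. F \<subseteq> frontier (region M)}"

text \<open>Conformity is the face-to-face condition contained in \<^const>\<open>triangulation\<close>. The last
  conjunct says that the normal of a face is exterior to one of the elements adjacent to it: on an
  interior face this leaves the orientation free, on a boundary face it forces the normal exterior
  to the domain.\<close>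

definition simplicial_mesh :: "('n::finite) mesh \<Rightarrow> bool" where
  "simplicial_mesh M \<longleftrightarrow>
     polyhedral_domain (region M) \<and>
     triangulation (elems M) \<and>
     (\<forall>K\<in>elems M. int CARD('n) simplex K) \<and>
     \<Union>(elems M) = closure (region M) \<and>
     (\<forall>F\<in>faces M. \<exists>K\<in>elems M. F facet_of K \<and> outward_normal K F (nrm M F))"

definition K_plus :: "('n::finite) mesh \<Rightarrow> (real^'n) set \<Rightarrow> (real^'n) set" where
  "K_plus M F = (THE K. K \<in> elems M \<and> F facet_of K \<and> outward_normal K F (nrm M F))"

definition K_minus :: "('n::finite) mesh \<Rightarrow> (real^'n) set \<Rightarrow> (real^'n) set" where
  "K_minus M F = (THE K. K \<in> elems M \<and> F facet_of K \<and> K \<noteq> K_plus M F)"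

section \<open>Lebesgue spaces and surface integrals\<close>

definition L2 :: "(real^'n) set \<Rightarrow> (real^'n \<Rightarrow> 'b::euclidean_space) \<Rightarrow> bool" where
  "L2 \<Omega> f \<longleftrightarrow>
     f \<in> borel_measurable (lebesgue_on \<Omega>) \<and> integrable (lebesgue_on \<Omega>) (\<lambda>x. (norm (f x))\<^sup>2)"

definition ip :: "(real^'n) set \<Rightarrow> (real^'n \<Rightarrow> 'b::euclidean_space) \<Rightarrow> (real^'n \<Rightarrow> 'b) \<Rightarrow> real" where
  "ip \<Omega> f g = (\<integral>x. f x \<bullet> g x \<partial>lebesgue_on \<Omega>)"

definition L2norm :: "(real^'n) set \<Rightarrow> (real^'n \<Rightarrow> 'b::euclidean_space) \<Rightarrow> real" where
  "L2norm \<Omega> f = sqrt (ip \<Omega> f f)"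

text \<open>The surface measure on the hyperplane \<open>{x. \<nu> \<bullet> x = c}\<close>, for a unit vector \<open>\<nu>\<close>: the measure of
  a subset is the volume of the right cylinder of height 1 over it, which by Fubini is its
  codimension-one Lebesgue measure.\<close>

definition hyperplane_measure :: "real^'n \<Rightarrow> real \<Rightarrow> (real^'n) measure" where
  "hyperplane_measure \<nu> c =
     distr (restrict_space lborel {x. c \<le> \<nu> \<bullet> x \<and> \<nu> \<bullet> x \<le> c + 1}) borel
       (\<lambda>x. x - (\<nu> \<bullet> x - c) *\<^sub>R \<nu>)"

text \<open>The offset does not depend on the point selected, as \<open>\<nu> \<bullet> x\<close> is constant on the face.\<close>

definition face_measure :: "('n::finite) mesh \<Rightarrow> (real^'n) set \<Rightarrow> (real^'n) measure" where
  "face_measure M F = hyperplane_measure (nrm M F) (nrm M F \<bullet> (SOME x. x \<in> F))"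

definition ipF :: "('n::finite) mesh \<Rightarrow> (real^'n) set \<Rightarrow>
    (real^'n \<Rightarrow> 'b::euclidean_space) \<Rightarrow> (real^'n \<Rightarrow> 'b) \<Rightarrow> real" where
  "ipF M F f g = set_lebesgue_integral (face_measure M F) F (\<lambda>x. f x \<bullet> g x)"

text \<open>Functions on a set of faces are indexed by the face and the point on it.\<close>

definition ip_faces :: "('n::finite) mesh \<Rightarrow> (real^'n) set set \<Rightarrow>
    ((real^'n) set \<Rightarrow> real^'n \<Rightarrow> 'b::euclidean_space) \<Rightarrow>
    ((real^'n) set \<Rightarrow> real^'n \<Rightarrow> 'b) \<Rightarrow> real" where
  "ip_faces M \<F> f g = (\<Sum>F\<in>\<F>. ipF M F (f F) (g F))"

section \<open>Piecewise polynomials\<close>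

definition Poly :: "nat \<Rightarrow> (real^'n \<Rightarrow> real) set" where
  "Poly j = {p. \<exists>c :: ('n \<Rightarrow> nat) \<Rightarrow> real.
     \<forall>x. p x = (\<Sum>\<alpha> | (\<Sum>i\<in>UNIV. \<alpha> i) \<le> j. c \<alpha> * (\<Prod>i\<in>UNIV. (x $ i) ^ \<alpha> i))}"

definition vPoly :: "nat \<Rightarrow> (real^'n \<Rightarrow> real^'n) set" where
  "vPoly j = {p. \<forall>i. (\<lambda>x. p x $ i) \<in> Poly j}"

definition agrees_on :: "(real^'n) set \<Rightarrow> (real^'n \<Rightarrow> 'b::euclidean_space) \<Rightarrow> (real^'n \<Rightarrow> 'b) \<Rightarrow> bool" where
  "agrees_on K f p \<longleftrightarrow> (AE x in lebesgue. x \<in> K \<longrightarrow> f x = p x)"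

text \<open>Members of \<^const>\<open>L2\<close> only matter up to null sets. For a piecewise polynomial \<open>\<phi>\<close>, the
  restriction to \<open>K\<close> is the polynomial that agrees with \<open>\<phi>\<close> almost everywhere on \<open>K\<close>; it is unique
  because elements have nonempty interior, and it provides the traces on the faces of \<open>K\<close>.\<close>

definition restr :: "(real^'n \<Rightarrow> 'b::euclidean_space) \<Rightarrow> (real^'n) set \<Rightarrow> real^'n \<Rightarrow> 'b" where
  "restr \<phi> K = (THE p. polynomial_function p \<and> agrees_on K \<phi> p)"

definition jump :: "('n::finite) mesh \<Rightarrow> (real^'n \<Rightarrow> 'b::euclidean_space) \<Rightarrow>
    (real^'n) set \<Rightarrow> real^'n \<Rightarrow> 'b" where
  "jump M \<phi> F x =
     (if F \<in> interior_faces M then restr \<phi> (K_plus M F) x - restr \<phi> (K_minus M F) x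
      else restr \<phi> (K_plus M F) x)"

definition avg :: "('n::finite) mesh \<Rightarrow> (real^'n \<Rightarrow> 'b::euclidean_space) \<Rightarrow>
    (real^'n) set \<Rightarrow> real^'n \<Rightarrow> 'b" where
  "avg M \<phi> F x =
     (if F \<in> interior_faces M
      then (1/2) *\<^sub>R (restr \<phi> (K_plus M F) x + restr \<phi> (K_minus M F) x)
      else restr \<phi> (K_plus M F) x)"

definition pderivative :: "'n \<Rightarrow> (real^'n \<Rightarrow> 'b::euclidean_space) \<Rightarrow> real^'n \<Rightarrow> 'b" where
  "pderivative j f x = frechet_derivative f (at x) (axis j 1)"

text \<open>Elementwise operators; their value on the skeleton, a null set, is immaterial.\<close>

definition div_h :: "('n::finite) mesh \<Rightarrow> (real^'n \<Rightarrow> real^'n) \<Rightarrow> real^'n \<Rightarrow> real" where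
  "div_h M v x = (\<Sum>K\<in>elems M. indicator (interior K) x *
     (\<Sum>j\<in>UNIV. pderivative j (restr v K) x $ j))"

definition adv_h :: "('n::finite) mesh \<Rightarrow> (real^'n \<Rightarrow> real^'n) \<Rightarrow> (real^'n \<Rightarrow> real^'n) \<Rightarrow>
    real^'n \<Rightarrow> real^'n" where
  "adv_h M \<beta> v x = (\<Sum>K\<in>elems M. indicator (interior K) x *\<^sub>R
     (\<Sum>j\<in>UNIV. (\<beta> x $ j) *\<^sub>R pderivative j (restr v K) x))"

section \<open>Weak divergence\<close>

text \<open>All iterated partial derivatives exist and are differentiable, that is, \<open>f\<close> is of class
  \<open>C\<^sup>\<infinity>\<close>.\<close>

coinductive smooth :: "(real^'n \<Rightarrow> real) \<Rightarrow> bool" where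
  "(\<And>x. f differentiable (at x)) \<Longrightarrow> (\<And>j. smooth (pderivative j f)) \<Longrightarrow> smooth f"

definition test_function :: "(real^'n) set \<Rightarrow> (real^'n \<Rightarrow> real) \<Rightarrow> bool" where
  "test_function \<Omega> \<phi> \<longleftrightarrow> smooth \<phi> \<and>
     compact (closure {x. \<phi> x \<noteq> 0}) \<and> closure {x. \<phi> x \<noteq> 0} \<subseteq> \<Omega>"

definition has_weak_div :: "(real^'n) set \<Rightarrow> (real^'n \<Rightarrow> real^'n) \<Rightarrow> (real^'n \<Rightarrow> real) \<Rightarrow> bool" where
  "has_weak_div \<Omega> v g \<longleftrightarrow>
     (\<forall>\<phi>. test_function \<Omega> \<phi> \<longrightarrow> ip \<Omega> v (\<lambda>x. \<chi> j. pderivative j \<phi> x) = - ip \<Omega> g \<phi>)"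

definition Hdiv :: "(real^'n) set \<Rightarrow> (real^'n \<Rightarrow> real^'n) set" where
  "Hdiv \<Omega> = {v. L2 \<Omega> v \<and> (\<exists>g. L2 \<Omega> g \<and> has_weak_div \<Omega> v g)}"

text \<open>Unique up to null sets on members of \<^const>\<open>Hdiv\<close>.\<close>

definition weak_div :: "(real^'n) set \<Rightarrow> (real^'n \<Rightarrow> real^'n) \<Rightarrow> real^'n \<Rightarrow> real" where
  "weak_div \<Omega> v = (SOME g. L2 \<Omega> g \<and> has_weak_div \<Omega> v g)"

section \<open>Discrete spaces\<close>

definition V_h :: "('n::finite) mesh \<Rightarrow> nat \<Rightarrow> (real^'n \<Rightarrow> real^'n) set" where
  "V_h M k = {v. L2 (region M) v \<and> (\<forall>K\<in>elems M. \<exists>p\<in>vPoly (k + 1). agrees_on K v p)}"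

definition Q_h :: "('n::finite) mesh \<Rightarrow> nat \<Rightarrow> (real^'n \<Rightarrow> real) set" where
  "Q_h M k = {q. L2 (region M) q \<and> (\<integral>x. q x \<partial>lebesgue_on (region M)) = 0 \<and>
     (\<forall>K\<in>elems M. \<exists>p\<in>Poly k. agrees_on K q p)}"

datatype hdiv_family = Raviart_Thomas | Brezzi_Douglas_Marini

fun local_space :: "hdiv_family \<Rightarrow> nat \<Rightarrow> (real^'n \<Rightarrow> real^'n) set" where
  "local_space Raviart_Thomas k = {\<lambda>x. p x + q x *\<^sub>R x | p q. p \<in> vPoly k \<and> q \<in> Poly k}"
| "local_space Brezzi_Douglas_Marini k = vPoly (k + 1)"

definition V_div :: "('n::finite) mesh \<Rightarrow> hdiv_family \<Rightarrow> nat \<Rightarrow> (real^'n \<Rightarrow> real^'n) set" where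
  "V_div M fam k = {v \<in> Hdiv (region M).
     (\<forall>K\<in>elems M. \<exists>p\<in>local_space fam k. agrees_on K v p) \<and>
     (\<forall>F\<in>boundary_faces M. \<forall>x\<in>F. restr v (K_plus M F) x \<bullet> nrm M F = 0)}"

section \<open>Forms\<close>

definition b_h :: "('n::finite) mesh \<Rightarrow> (real^'n \<Rightarrow> real^'n) \<Rightarrow> (real^'n \<Rightarrow> real) \<Rightarrow> real" where
  "b_h M v q = ip (region M) (div_h M v) q
     - ip_faces M (faces M) (\<lambda>F x. jump M v F x \<bullet> nrm M F) (avg M q)"

definition d_h :: "('n::finite) mesh \<Rightarrow> real \<Rightarrow> (real^'n \<Rightarrow> real^'n) \<Rightarrow> (real^'n \<Rightarrow> real^'n) \<Rightarrow> real" where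
  "d_h M \<gamma> u v = \<gamma> *
     ((\<Sum>F\<in>faces M. inverse (diameter F) *
         ipF M F (\<lambda>x. jump M u F x \<bullet> nrm M F) (\<lambda>x. jump M v F x \<bullet> nrm M F))
      + ip (region M) (div_h M u) (div_h M v))"

text \<open>The two convective forms, at equal first and second arguments: \<open>c1 M \<theta> \<zeta> u v\<close> stands for
  \<open>c\<^sup>1(u; u, v)\<close>.\<close>

definition c1 :: "('n::finite) mesh \<Rightarrow> real \<Rightarrow> ((real^'n) set \<Rightarrow> real) \<Rightarrow>
    (real^'n \<Rightarrow> real^'n) \<Rightarrow> (real^'n \<Rightarrow> real^'n) \<Rightarrow> real" where
  "c1 M \<theta> \<zeta> u v =
       ip (region M) (adv_h M u u) v
     + 1/2 * ip (region M) (\<lambda>x. div_h M u x *\<^sub>R u x) v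
     - ip_faces M (interior_faces M) (\<lambda>F x. (avg M u F x \<bullet> nrm M F) *\<^sub>R jump M u F x) (avg M v)
     - 1/2 * ip_faces M (interior_faces M)
         (\<lambda>F x. jump M u F x \<bullet> nrm M F) (avg M (\<lambda>x. u x \<bullet> v x))
     + ip_faces M (faces M)
         (\<lambda>F x. (\<zeta> F * \<bar>avg M u F x \<bullet> nrm M F\<bar>) *\<^sub>R jump M u F x) (jump M v)
     + \<theta> * ip_faces M (interior_faces M)
         (\<lambda>F x. (avg M v F x \<bullet> nrm M F) *\<^sub>R jump M u F x) (avg M u)
     + \<theta>/2 * ip_faces M (interior_faces M)
         (\<lambda>F x. jump M v F x \<bullet> nrm M F) (avg M (\<lambda>x. u x \<bullet> u x))
     - \<theta> * ip (region M) (adv_h M v u) u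
     - \<theta>/2 * ip (region M) (\<lambda>x. div_h M v x *\<^sub>R u x) u"

definition c2 :: "('n::finite) mesh \<Rightarrow> real \<Rightarrow> ((real^'n) set \<Rightarrow> real) \<Rightarrow>
    (real^'n \<Rightarrow> real^'n) \<Rightarrow> (real^'n \<Rightarrow> real^'n) \<Rightarrow> real" where
  "c2 M \<theta> \<zeta> u v =
       ip (region M) (adv_h M u u) v
     + (1 - \<theta>)/2 * ip (region M) (\<lambda>x. div_h M u x *\<^sub>R u x) v
     - ip_faces M (interior_faces M) (\<lambda>F x. (avg M u F x \<bullet> nrm M F) *\<^sub>R jump M u F x) (avg M v)
     - (1 - \<theta>)/2 * ip_faces M (interior_faces M)
         (\<lambda>F x. jump M u F x \<bullet> nrm M F) (avg M (\<lambda>x. u x \<bullet> v x))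
     + ip_faces M (faces M)
         (\<lambda>F x. (\<zeta> F * \<bar>avg M u F x \<bullet> nrm M F\<bar>) *\<^sub>R jump M u F x) (jump M v)
     + \<theta> * ip_faces M (interior_faces M)
         (\<lambda>F x. (avg M v F x \<bullet> nrm M F) *\<^sub>R jump M u F x) (avg M u)
     - \<theta> * ip (region M) (adv_h M v u) u"

section \<open>Semi-discrete trajectories\<close>

text \<open>The map \<open>t \<mapsto> u t\<close> into the finite-dimensional space \<open>V\<close>, normed by the \<open>L\<^sup>2\<close> norm, is
  continuous on \<open>[0, T]\<close> and differentiable on \<open>(0, T]\<close> with derivative \<open>u'\<close> (one-sided at \<open>T\<close>).\<close>

definition trajectory :: "(real^'n) set \<Rightarrow> (real^'n \<Rightarrow> real^'n) set \<Rightarrow> real \<Rightarrow>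
    (real \<Rightarrow> real^'n \<Rightarrow> real^'n) \<Rightarrow> (real \<Rightarrow> real^'n \<Rightarrow> real^'n) \<Rightarrow> bool" where
  "trajectory \<Omega> V T u u' \<longleftrightarrow>
     (\<forall>t\<in>{0..T}. u t \<in> V \<and>
        ((\<lambda>s. L2norm \<Omega> (\<lambda>x. u s x - u t x)) \<longlongrightarrow> 0) (at t within {0..T})) \<and>
     (\<forall>t\<in>{0<..T}. u' t \<in> V \<and>
        ((\<lambda>s. L2norm \<Omega> (\<lambda>x. (u s x - u t x) /\<^sub>R (s - t) - u' t x)) \<longlongrightarrow> 0) (at t within {0..T}))"

end

theory Submission
  imports Defs
begin

text \<open>
Testing the momentum equation with the velocity \<open>u\<close> itself gives
\<open>(u', u) + c_h(u; u, u) + d_h(u, u) = 0\<close>, the pressure term being zero by the discrete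
incompressibility constraint (and \<open>d_h\<close> absent in the \<open>H(div)\<close> scheme). Since \<open>d_h(u, u) \<ge> 0\<close>, the
squared norm of \<open>u\<close>, with derivative \<open>2 (u', u)\<close>, does not increase if \<open>c_h(u; u, u) \<ge> 0\<close>;
this step is \<open>trajectory_energy_decreasing\<close>.

The sign of the convective term comes from an energy identity. On one element \<open>K\<close> with exterior
normal \<open>\<nu>\<close>, the divergence theorem for \<open>\<bar>u\<bar>\<^sup>2 u\<close> gives
\<open>(u \<bullet> \<nabla> u, u) + 1/2 ((\<nabla> \<bullet> u) u, u) = 1/2 \<integral> (u \<bullet> \<nu>) \<bar>u\<bar>\<^sup>2\<close>, the last integral over the boundary of \<open>K\<close>.
Summing over the elements, the two contributions to an interior face are exactly cancelled by the
consistency terms of the forms (\<open>convective_bracket\<close>). What remains is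
\<open>(1 - \<theta>) / 2 \<integral> (u \<bullet> n) \<bar>u\<bar>\<^sup>2\<close> over the boundary faces and the non-negative stabilization. The
former is absorbed by the stabilization if \<open>\<zeta> \<ge> \<bar>1 - \<theta>\<bar> / 2\<close> on the boundary, and it vanishes if
\<open>u \<bullet> n = 0\<close> there (\<open>convective_energy\<close>).

Two ingredients carry the identity. The first is the divergence theorem on a simplex, for the
surface measure defined through cylinders (\<open>simplex_divergence\<close>). It is proved for the direction of
an edge, where every line enters and leaves the simplex through the same two facets, by Fubini along
the lines parallel to the edge; edges span all directions. The second is the combinatorics of the
mesh: each face is shared by two elements on opposite sides, whose exterior normals are opposite, or
belongs to only one element, and then it lies on the boundary of the domain
(\<open>K_plus\<close>, \<open>K_minus\<close>, \<open>exterior_face_boundary\<close>).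
\<close>

section \<open>Integration along parallel lines\<close>

lemma nn_integral_lborel_translate:
  fixes f :: "'a::euclidean_space \<Rightarrow> ennreal"
  assumes [measurable]: "f \<in> borel_measurable borel"
  shows "(\<integral>\<^sup>+x. f (x + a) \<partial>lborel) = (\<integral>\<^sup>+x. f x \<partial>lborel)"
proof -
  have "(\<integral>\<^sup>+x. f x \<partial>lborel) = (\<integral>\<^sup>+x. f x \<partial>distr lborel borel ((+) a))"
    by (simp add: lborel_distr_plus)
  also have "\<dots> = (\<integral>\<^sup>+x. f (a + x) \<partial>lborel)"
    by (simp add: nn_integral_distr)
  finally show ?thesis by (simp add: add.commute)
qed

text \<open>Substituting \<open>x \<mapsto> x - t e\<close> for each fixed \<open>t\<close> and exchanging the integrals splits an integral over
the space into integrals over the lines parallel to \<open>e\<close>, without choosing a complement of \<open>e\<close> or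
coordinates: the weight \<open>w\<close> takes over the role of a transversal.\<close>

lemma nn_integral_along_lines:
  fixes e :: "'a::euclidean_space" and w h :: "'a \<Rightarrow> ennreal"
  assumes [measurable]: "w \<in> borel_measurable borel" "h \<in> borel_measurable borel"
  shows "(\<integral>\<^sup>+x. (\<integral>\<^sup>+t. w x * h (x + t *\<^sub>R e) \<partial>lborel) \<partial>lborel) =
         (\<integral>\<^sup>+x. h x * (\<integral>\<^sup>+t. w (x - t *\<^sub>R e) \<partial>lborel) \<partial>lborel)"
proof -
  have "(\<integral>\<^sup>+x. (\<integral>\<^sup>+t. w x * h (x + t *\<^sub>R e) \<partial>lborel) \<partial>lborel) =
        (\<integral>\<^sup>+t. (\<integral>\<^sup>+x. w x * h (x + t *\<^sub>R e) \<partial>lborel) \<partial>lborel)"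
    by (rule lborel_pair.Fubini'[symmetric]) measurable
  also have "\<dots> = (\<integral>\<^sup>+t. (\<integral>\<^sup>+x. w (x - t *\<^sub>R e) * h x \<partial>lborel) \<partial>lborel)"
  proof (rule nn_integral_cong)
    fix t :: real
    have "(\<integral>\<^sup>+x. w (x - t *\<^sub>R e) * h x \<partial>lborel) =
          (\<integral>\<^sup>+x. w (x + t *\<^sub>R e - t *\<^sub>R e) * h (x + t *\<^sub>R e) \<partial>lborel)"
      by (rule nn_integral_lborel_translate[symmetric]) measurable
    then show "(\<integral>\<^sup>+x. w x * h (x + t *\<^sub>R e) \<partial>lborel) = (\<integral>\<^sup>+x. w (x - t *\<^sub>R e) * h x \<partial>lborel)"
      by simp
  qed
  also have "\<dots> = (\<integral>\<^sup>+x. (\<integral>\<^sup>+t. w (x - t *\<^sub>R e) * h x \<partial>lborel) \<partial>lborel)"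
    by (rule lborel_pair.Fubini') measurable
  also have "\<dots> = (\<integral>\<^sup>+x. h x * (\<integral>\<^sup>+t. w (x - t *\<^sub>R e) \<partial>lborel) \<partial>lborel)"
    by (intro nn_integral_cong, subst nn_integral_multc) (measurable, simp add: mult.commute)
  finally show ?thesis .
qed

text \<open>A smeared-out cross-section of the family of lines parallel to \<open>e\<close>: every line carries total weight
one.\<close>

definition unit_weight :: "'a::euclidean_space \<Rightarrow> ('a \<Rightarrow> real) \<Rightarrow> bool" where
  "unit_weight e w \<longleftrightarrow> w \<in> borel_measurable borel \<and> (\<forall>x. 0 \<le> w x) \<and>
     (\<forall>x. (\<integral>\<^sup>+t. ennreal (w (x - t *\<^sub>R e)) \<partial>lborel) = 1)"

lemma integral_along_lines:
  fixes e :: "'a::euclidean_space" and h w :: "'a \<Rightarrow> real"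
  assumes h: "integrable lborel h" and w: "unit_weight e w"
  shows "(\<integral>x. h x \<partial>lborel) = (\<integral>x. w x * (\<integral>t. h (x + t *\<^sub>R e) \<partial>lborel) \<partial>lborel)"
proof -
  have [measurable]: "w \<in> borel_measurable borel" "h \<in> borel_measurable borel"
    and wp: "\<And>x. 0 \<le> w x" and w1: "\<And>x. (\<integral>\<^sup>+t. ennreal (w (x - t *\<^sub>R e)) \<partial>lborel) = 1"
    using h w by (auto simp: unit_weight_def)
  have fin: "(\<integral>\<^sup>+x. ennreal \<bar>h x\<bar> \<partial>lborel) < \<infinity>"
    using h by (simp add: integrable_iff_bounded)
  have I1: "integrable (lborel \<Otimes>\<^sub>M lborel) (\<lambda>(x, t). w x * h (x + t *\<^sub>R e))"
  proof (rule integrableI_bounded)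
    show "(\<lambda>(x, t). w x * h (x + t *\<^sub>R e)) \<in> borel_measurable (lborel \<Otimes>\<^sub>M lborel)" by measurable
    have "(\<integral>\<^sup>+z. ennreal (norm (case z of (x, t) \<Rightarrow> w x * h (x + t *\<^sub>R e))) \<partial>(lborel \<Otimes>\<^sub>M lborel))
        = (\<integral>\<^sup>+x. (\<integral>\<^sup>+t. ennreal (w x) * ennreal \<bar>h (x + t *\<^sub>R e)\<bar> \<partial>lborel) \<partial>lborel)"
      by (subst lborel.nn_integral_fst[symmetric]) (simp_all add: abs_mult wp ennreal_mult)
    also have "\<dots> = (\<integral>\<^sup>+x. ennreal \<bar>h x\<bar> \<partial>lborel)"
      by (subst nn_integral_along_lines[where w="\<lambda>x. ennreal (w x)" and h="\<lambda>x. ennreal \<bar>h x\<bar>"])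
         (simp_all add: w1)
    finally show "(\<integral>\<^sup>+z. ennreal (norm (case z of (x, t) \<Rightarrow> w x * h (x + t *\<^sub>R e))) \<partial>(lborel \<Otimes>\<^sub>M lborel)) < \<infinity>"
      using fin by simp
  qed
  have I2: "integrable (lborel \<Otimes>\<^sub>M lborel) (\<lambda>(x, t). w (x - t *\<^sub>R e) * h x)"
  proof (rule integrableI_bounded)
    show "(\<lambda>(x, t). w (x - t *\<^sub>R e) * h x) \<in> borel_measurable (lborel \<Otimes>\<^sub>M lborel)" by measurable
    have "(\<integral>\<^sup>+z. ennreal (norm (case z of (x, t) \<Rightarrow> w (x - t *\<^sub>R e) * h x)) \<partial>(lborel \<Otimes>\<^sub>M lborel))
        = (\<integral>\<^sup>+x. (\<integral>\<^sup>+t. ennreal (w (x - t *\<^sub>R e)) * ennreal \<bar>h x\<bar> \<partial>lborel) \<partial>lborel)"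
      by (subst lborel.nn_integral_fst[symmetric]) (simp_all add: abs_mult wp ennreal_mult)
    also have "\<dots> = (\<integral>\<^sup>+x. ennreal \<bar>h x\<bar> \<partial>lborel)"
      by (subst nn_integral_multc) (simp_all add: w1)
    finally show "(\<integral>\<^sup>+z. ennreal (norm (case z of (x, t) \<Rightarrow> w (x - t *\<^sub>R e) * h x)) \<partial>(lborel \<Otimes>\<^sub>M lborel)) < \<infinity>"
      using fin by simp
  qed
  have w1': "(\<integral>t. w (x - t *\<^sub>R e) \<partial>lborel) = 1" for x
    by (subst integral_eq_nn_integral) (simp_all add: wp w1)
  have "(\<integral>x. w x * (\<integral>t. h (x + t *\<^sub>R e) \<partial>lborel) \<partial>lborel)
      = (\<integral>x. (\<integral>t. w x * h (x + t *\<^sub>R e) \<partial>lborel) \<partial>lborel)"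
    by simp
  also have "\<dots> = (\<integral>t. (\<integral>x. w x * h (x + t *\<^sub>R e) \<partial>lborel) \<partial>lborel)"
    by (rule lborel_pair.Fubini_integral[OF I1, symmetric])
  also have "\<dots> = (\<integral>t. (\<integral>x. w (x - t *\<^sub>R e) * h x \<partial>lborel) \<partial>lborel)"
  proof (rule Bochner_Integration.integral_cong[OF refl])
    fix t :: real
    have "(\<integral>x. w (x - t *\<^sub>R e) * h x \<partial>lborel) =
          (\<integral>x. w (x - t *\<^sub>R e) * h x \<partial>distr lborel borel ((+) (t *\<^sub>R e)))"
      by (simp add: lborel_distr_plus)
    also have "\<dots> = (\<integral>x. w x * h (t *\<^sub>R e + x) \<partial>lborel)"
      by (subst integral_distr) simp_all
    finally show "(\<integral>x. w x * h (x + t *\<^sub>R e) \<partial>lborel) = (\<integral>x. w (x - t *\<^sub>R e) * h x \<partial>lborel)"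
      by (simp add: add.commute)
  qed
  also have "\<dots> = (\<integral>x. (\<integral>t. w (x - t *\<^sub>R e) * h x \<partial>lborel) \<partial>lborel)"
    by (rule lborel_pair.Fubini_integral[OF I2])
  also have "\<dots> = (\<integral>x. h x \<partial>lborel)"
    by (simp add: w1')
  finally show ?thesis ..
qed

text \<open>A line parallel to \<open>e\<close> stays in the slab of width one for a parameter interval of length
\<open>1 / \<bar>a \<bullet> e\<bar>\<close>.\<close>

lemma unit_weight_slab:
  fixes a e :: "'a::euclidean_space"
  assumes "a \<bullet> e \<noteq> 0"
  shows "unit_weight e (\<lambda>x. \<bar>a \<bullet> e\<bar> * indicator {y. c \<le> a \<bullet> y \<and> a \<bullet> y \<le> c + 1} x)"
  unfolding unit_weight_def
proof (intro conjI allI)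
  show "(\<lambda>x. \<bar>a \<bullet> e\<bar> * indicator {y. c \<le> a \<bullet> y \<and> a \<bullet> y \<le> c + 1} x) \<in> borel_measurable borel"
    by measurable
  fix x :: 'a
  show "0 \<le> \<bar>a \<bullet> e\<bar> * indicator {y. c \<le> a \<bullet> y \<and> a \<bullet> y \<le> c + 1} x" by simp
  have "(\<integral>\<^sup>+s. indicator {c..c+1} s \<partial>lborel) =
        ennreal \<bar>- (a \<bullet> e)\<bar> * (\<integral>\<^sup>+t. indicator {c..c+1} (a \<bullet> x + (- (a \<bullet> e)) * t) \<partial>lborel)"
    by (rule nn_integral_real_affine) (use assms in auto)
  also have "(\<lambda>t. indicator {c..c+1} (a \<bullet> x + (- (a \<bullet> e)) * t)) =
     (\<lambda>t. indicator {y. c \<le> a \<bullet> y \<and> a \<bullet> y \<le> c + 1} (x - t *\<^sub>R e) :: ennreal)"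
    by (auto simp: fun_eq_iff indicator_def inner_diff_right algebra_simps)
  finally show "(\<integral>\<^sup>+t. ennreal (\<bar>a \<bullet> e\<bar> * indicator {y. c \<le> a \<bullet> y \<and> a \<bullet> y \<le> c + 1} (x - t *\<^sub>R e)) \<partial>lborel) = 1"
    by (simp add: ennreal_mult nn_integral_cmult ennreal_indicator)
qed

text \<open>A shear translates each line parallel to \<open>w\<close> along itself, by an amount that depends on the line
only. So it preserves the integral over each line, hence the volume.\<close>

lemma lborel_distr_shear:
  fixes w :: "'a::euclidean_space" and \<phi> :: "'a \<Rightarrow> real"
  assumes [measurable]: "\<phi> \<in> borel_measurable borel" and inv: "\<And>x t. \<phi> (x + t *\<^sub>R w) = \<phi> x"
  shows "distr lborel borel (\<lambda>x. x + \<phi> x *\<^sub>R w) = lborel"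
proof (cases "w = 0")
  case True
  then show ?thesis by (simp add: distr_id2)
next
  case False
  define W where "W x = \<bar>w \<bullet> w\<bar> * indicator {y. 0 \<le> w \<bullet> y \<and> w \<bullet> y \<le> 0 + 1} x" for x
  have "unit_weight w W"
    unfolding W_def by (rule unit_weight_slab) (use False in simp)
  then have [measurable]: "W \<in> borel_measurable borel" and 
    w1: "\<And>x. (\<integral>\<^sup>+t. ennreal (W (x - t *\<^sub>R w)) \<partial>lborel) = 1"
    by (auto simp: unit_weight_def)
  show ?thesis
  proof (rule measure_eqI)
    fix A assume "A \<in> sets (distr lborel borel (\<lambda>x. x + \<phi> x *\<^sub>R w))"
    then have [measurable]: "A \<in> sets borel" by simp
    \<comment> \<open>Both sides are compared after averaging along the lines parallel to
      \<open>w\<close>.\<close>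
    have av: "(\<integral>\<^sup>+x. h x \<partial>lborel) = (\<integral>\<^sup>+x. (\<integral>\<^sup>+t. ennreal (W x) * h (x + t *\<^sub>R w) \<partial>lborel) \<partial>lborel)"
      if [measurable]: "h \<in> borel_measurable borel" for h
      using nn_integral_along_lines[of "\<lambda>x. ennreal (W x)" h w] by (simp add: w1)
    have "emeasure (distr lborel borel (\<lambda>x. x + \<phi> x *\<^sub>R w)) A
        = (\<integral>\<^sup>+x. indicator A x \<partial>distr lborel borel (\<lambda>x. x + \<phi> x *\<^sub>R w))"
      by simp
    also have "\<dots> = (\<integral>\<^sup>+x. indicator A (x + \<phi> x *\<^sub>R w) \<partial>lborel)"
      by (rule nn_integral_distr) measurable
    also have "\<dots> = (\<integral>\<^sup>+x. (\<integral>\<^sup>+t. ennreal (W x) * indicator A (x + (\<phi> x + 1 * t) *\<^sub>R w) \<partial>lborel) \<partial>lborel)"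
      by (subst av) (measurable, simp add: inv scaleR_add_left add.commute add.left_commute)
    also have "\<dots> = (\<integral>\<^sup>+x. (\<integral>\<^sup>+t. ennreal (W x) * indicator A (x + t *\<^sub>R w) \<partial>lborel) \<partial>lborel)"
    proof (rule nn_integral_cong)
      fix x
      show "(\<integral>\<^sup>+t. ennreal (W x) * indicator A (x + (\<phi> x + 1 * t) *\<^sub>R w) \<partial>lborel)
          = (\<integral>\<^sup>+t. ennreal (W x) * indicator A (x + t *\<^sub>R w) \<partial>lborel)"
        by (subst nn_integral_real_affine[where c=1 and t="\<phi> x" and f="\<lambda>t. ennreal (W x) * indicator A (x + t *\<^sub>R w)"])
           simp_all
    qed
    also have "\<dots> = (\<integral>\<^sup>+x. indicator A x \<partial>lborel)"
      by (rule av[symmetric]) measurable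
    finally show "emeasure (distr lborel borel (\<lambda>x. x + \<phi> x *\<^sub>R w)) A = emeasure lborel A"
      by simp
  qed simp
qed

section \<open>Integrals over pieces of hyperplanes\<close>

lemma integral_lborel_translate:
  fixes f :: "'a::euclidean_space \<Rightarrow> real"
  assumes [measurable]: "f \<in> borel_measurable borel"
  shows "(\<integral>x. f (x + a) \<partial>lborel) = (\<integral>x. f x \<partial>lborel)"
proof -
  have "(\<integral>x. f x \<partial>lborel) = (\<integral>x. f x \<partial>distr lborel borel ((+) a))"
    by (simp add: lborel_distr_plus)
  also have "\<dots> = (\<integral>x. f (a + x) \<partial>lborel)"
    by (simp add: integral_distr)
  finally show ?thesis by (simp add: add.commute)
qed

lemma sets_hyperplane_measure [measurable_cong, simp]: "sets (hyperplane_measure \<nu> c) = sets borel"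
  by (simp add: hyperplane_measure_def)

lemma integral_hyperplane_measure:
  fixes \<nu> :: "real^'n" and G :: "real^'n \<Rightarrow> real"
  assumes [measurable]: "G \<in> borel_measurable borel"
  shows "(\<integral>y. G y \<partial>hyperplane_measure \<nu> c) =
    (\<integral>x. indicator {x. c \<le> \<nu> \<bullet> x \<and> \<nu> \<bullet> x \<le> c + 1} x * G (x - (\<nu> \<bullet> x - c) *\<^sub>R \<nu>) \<partial>lborel)"
proof -
  have "(\<lambda>x. x - (\<nu> \<bullet> x - c) *\<^sub>R \<nu>) \<in> restrict_space lborel {x. c \<le> \<nu> \<bullet> x \<and> \<nu> \<bullet> x \<le> c + 1} \<rightarrow>\<^sub>M borel"
    by (rule measurable_restrict_space1) measurable
  from integral_distr[OF this assms] show ?thesis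
    by (simp add: hyperplane_measure_def integral_restrict_space)
qed

lemma integrable_hyperplane_measure:
  fixes \<nu> :: "real^'n" and G :: "real^'n \<Rightarrow> real"
  assumes [measurable]: "G \<in> borel_measurable borel"
  shows "integrable (hyperplane_measure \<nu> c) G \<longleftrightarrow>
    integrable lborel (\<lambda>x. indicator {x. c \<le> \<nu> \<bullet> x \<and> \<nu> \<bullet> x \<le> c + 1} x * G (x - (\<nu> \<bullet> x - c) *\<^sub>R \<nu>))"
proof -
  have "(\<lambda>x. x - (\<nu> \<bullet> x - c) *\<^sub>R \<nu>) \<in> restrict_space lborel {x. c \<le> \<nu> \<bullet> x \<and> \<nu> \<bullet> x \<le> c + 1} \<rightarrow>\<^sub>M borel"
    by (rule measurable_restrict_space1) measurable
  from integrable_distr_eq[OF this assms] show ?thesis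
    by (simp add: hyperplane_measure_def integrable_restrict_space)
qed

text \<open>Reversing the normal replaces the cylinder over the hyperplane by the one on its other side, a
translate by \<open>\<nu>\<close>. So both elements adjacent to a face, whose exterior normals are opposite,
integrate over it with the same measure.\<close>

lemma integral_hyperplane_measure_uminus:
  fixes \<nu> :: "real^'n" and G :: "real^'n \<Rightarrow> real"
  assumes [measurable]: "G \<in> borel_measurable borel" and n: "norm \<nu> = 1"
  shows "(\<integral>y. G y \<partial>hyperplane_measure (- \<nu>) (- c)) = (\<integral>y. G y \<partial>hyperplane_measure \<nu> c)"
proof -
  have nn: "\<nu> \<bullet> \<nu> = 1" using n by (simp add: dot_square_norm)
  let ?h = "\<lambda>x. indicator {x. - c \<le> - \<nu> \<bullet> x \<and> - \<nu> \<bullet> x \<le> - c + 1} x * G (x - (- \<nu> \<bullet> x - - c) *\<^sub>R (- \<nu>))"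
  have "(\<integral>y. G y \<partial>hyperplane_measure (- \<nu>) (- c)) = (\<integral>x. ?h x \<partial>lborel)"
    by (rule integral_hyperplane_measure) measurable
  also have "\<dots> = (\<integral>x. ?h (x + (- \<nu>)) \<partial>lborel)"
    by (rule integral_lborel_translate[symmetric]) measurable
  also have "(\<lambda>x. ?h (x + (- \<nu>))) =
      (\<lambda>x. indicator {x. c \<le> \<nu> \<bullet> x \<and> \<nu> \<bullet> x \<le> c + 1} x * G (x - (\<nu> \<bullet> x - c) *\<^sub>R \<nu>))"
    by (auto simp: fun_eq_iff indicator_def inner_diff_right nn algebra_simps)
  also have "(\<integral>x. \<dots> x \<partial>lborel) = (\<integral>y. G y \<partial>hyperplane_measure \<nu> c)"
    by (rule integral_hyperplane_measure[symmetric]) measurable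
  finally show ?thesis .
qed

text \<open>The right cylinder of the definition and the oblique cylinder with axis \<open>e\<close> have the same base and
height, and a shear along the hyperplane carries one to the other.\<close>

lemma integral_hyperplane_measure_oblique:
  fixes \<nu> e :: "real^'n" and G :: "real^'n \<Rightarrow> real"
  assumes [measurable]: "G \<in> borel_measurable borel" and n: "norm \<nu> = 1" and e: "\<nu> \<bullet> e \<noteq> 0"
  shows "(\<integral>y. G y \<partial>hyperplane_measure \<nu> c) =
    (\<integral>x. indicator {x. c \<le> \<nu> \<bullet> x \<and> \<nu> \<bullet> x \<le> c + 1} x * G (x - ((\<nu> \<bullet> x - c) / (\<nu> \<bullet> e)) *\<^sub>R e) \<partial>lborel)"
proof -
  have nn: "\<nu> \<bullet> \<nu> = 1" using n by (simp add: dot_square_norm)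
  \<comment> \<open>The axis of the oblique cylinder, scaled to height one, is \<open>\<nu> +
    w\<close>.\<close>
  define w where "w = (1 / (\<nu> \<bullet> e)) *\<^sub>R e - \<nu>"
  have nw: "\<nu> \<bullet> w = 0" using e nn by (simp add: w_def inner_diff_right)
  let ?h = "\<lambda>x. indicator {x. c \<le> \<nu> \<bullet> x \<and> \<nu> \<bullet> x \<le> c + 1} x * G (x - (\<nu> \<bullet> x - c) *\<^sub>R \<nu>)"
  have "(\<integral>y. G y \<partial>hyperplane_measure \<nu> c) = (\<integral>x. ?h x \<partial>lborel)"
    by (rule integral_hyperplane_measure) measurable
  also have "\<dots> = (\<integral>x. ?h x \<partial>distr lborel borel (\<lambda>x. x + (c - \<nu> \<bullet> x) *\<^sub>R w))"
    by (subst lborel_distr_shear) (simp_all add: inner_add_right nw)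
  also have "\<dots> = (\<integral>x. ?h (x + (c - \<nu> \<bullet> x) *\<^sub>R w) \<partial>lborel)"
    by (rule integral_distr) measurable
  also have "(\<lambda>x. ?h (x + (c - \<nu> \<bullet> x) *\<^sub>R w)) =
     (\<lambda>x. indicator {x. c \<le> \<nu> \<bullet> x \<and> \<nu> \<bullet> x \<le> c + 1} x * G (x - ((\<nu> \<bullet> x - c) / (\<nu> \<bullet> e)) *\<^sub>R e))"
  proof
    fix x
    have 1: "\<nu> \<bullet> (x + (c - \<nu> \<bullet> x) *\<^sub>R w) = \<nu> \<bullet> x" by (simp add: inner_add_right nw)
    have 2: "x + (c - \<nu> \<bullet> x) *\<^sub>R w - (\<nu> \<bullet> x - c) *\<^sub>R \<nu> = x - ((\<nu> \<bullet> x - c) / (\<nu> \<bullet> e)) *\<^sub>R e"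
      by (simp add: w_def scaleR_diff_right diff_divide_distrib scaleR_diff_left)
    show "?h (x + (c - \<nu> \<bullet> x) *\<^sub>R w) = indicator {x. c \<le> \<nu> \<bullet> x \<and> \<nu> \<bullet> x \<le> c + 1} x * G (x - ((\<nu> \<bullet> x - c) / (\<nu> \<bullet> e)) *\<^sub>R e)"
      unfolding 1 2 by (simp add: indicator_def 1)
  qed
  finally show ?thesis .
qed

lemma integrable_slab_projection:
  fixes \<nu> e :: "real^'n" and G :: "real^'n \<Rightarrow> real"
  assumes [measurable]: "G \<in> borel_measurable borel" and e: "\<nu> \<bullet> e \<noteq> 0"
    and G: "\<And>x. \<bar>G x\<bar> \<le> B" and supp: "\<And>x. G x \<noteq> 0 \<Longrightarrow> norm x \<le> R"
  shows "integrable lborel (\<lambda>x. indicator {x. c \<le> \<nu> \<bullet> x \<and> \<nu> \<bullet> x \<le> c + 1} x * G (x - ((\<nu> \<bullet> x - c) / (\<nu> \<bullet> e)) *\<^sub>R e))"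
proof (rule integrableI_bounded_set[where A="cball 0 (R + norm e / \<bar>\<nu> \<bullet> e\<bar>)" and B=B])
  show "AE x\<in>cball 0 (R + norm e / \<bar>\<nu> \<bullet> e\<bar>) in lborel.
       norm (indicator {x. c \<le> \<nu> \<bullet> x \<and> \<nu> \<bullet> x \<le> c + 1} x * G (x - ((\<nu> \<bullet> x - c) / (\<nu> \<bullet> e)) *\<^sub>R e)) \<le> B"
    using G G[of 0, THEN order_trans[OF abs_ge_zero]] by (auto simp: indicator_def abs_mult)
  have "indicator {x. c \<le> \<nu> \<bullet> x \<and> \<nu> \<bullet> x \<le> c + 1} x * G (x - ((\<nu> \<bullet> x - c) / (\<nu> \<bullet> e)) *\<^sub>R e) = 0"
    if "x \<notin> cball 0 (R + norm e / \<bar>\<nu> \<bullet> e\<bar>)" for x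
  proof (rule ccontr)
    let ?s = "(\<nu> \<bullet> x - c) / (\<nu> \<bullet> e)"
    assume "\<not> ?thesis"
    then have s: "c \<le> \<nu> \<bullet> x" "\<nu> \<bullet> x \<le> c + 1" and "G (x - ?s *\<^sub>R e) \<noteq> 0"
      by (auto simp: indicator_def split: if_splits)
    then have "norm (x - ?s *\<^sub>R e) \<le> R" using supp by blast
    moreover have "norm (?s *\<^sub>R e) \<le> norm e / \<bar>\<nu> \<bullet> e\<bar>"
      using s mult_right_mono[of "\<bar>\<nu> \<bullet> x - c\<bar>" 1 "norm e"] by (simp add: divide_right_mono)
    ultimately have "norm x \<le> R + norm e / \<bar>\<nu> \<bullet> e\<bar>"
      using norm_triangle_ineq[of "x - ?s *\<^sub>R e" "?s *\<^sub>R e"] by simp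
    then show False using that by simp
  qed
  then show "AE x in lborel. x \<notin> cball 0 (R + norm e / \<bar>\<nu> \<bullet> e\<bar>) \<longrightarrow>
      indicator {x. c \<le> \<nu> \<bullet> x \<and> \<nu> \<bullet> x \<le> c + 1} x * G (x - ((\<nu> \<bullet> x - c) / (\<nu> \<bullet> e)) *\<^sub>R e) = 0"
    by blast
  show "emeasure lborel (cball 0 (R + norm e / \<bar>\<nu> \<bullet> e\<bar>)) < \<infinity>"
    by (rule emeasure_bounded_finite) simp
qed simp_all

lemma indicator_mult_bounds:
  fixes g :: "real^'n \<Rightarrow> real"
  assumes "compact F" "continuous_on UNIV g"
  obtains B R where "\<And>x. \<bar>indicator F x * g x\<bar> \<le> B" "\<And>x. indicator F x * g x \<noteq> 0 \<Longrightarrow> norm x \<le> R"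
proof -
  have "bounded (g ` F)"
    using assms by (meson compact_continuous_image compact_imp_bounded continuous_on_subset subset_UNIV)
  then obtain B where B: "B > 0" "\<And>x. x \<in> F \<Longrightarrow> \<bar>g x\<bar> \<le> B"
    by (auto simp: bounded_pos)
  obtain R where R: "\<And>x. x \<in> F \<Longrightarrow> norm x \<le> R"
    using compact_imp_bounded[OF assms(1)] by (auto simp: bounded_iff)
  show ?thesis by (rule that[of B R]) (use B R in \<open>auto simp: indicator_def split: if_splits\<close>)
qed

lemma indicator_mult_borel:
  fixes g :: "real^'n \<Rightarrow> real"
  assumes "compact F" "continuous_on UNIV g"
  shows "(\<lambda>x. indicator F x * g x) \<in> borel_measurable borel"
proof -
  have [measurable]: "F \<in> sets borel" "g \<in> borel_measurable borel"
    using assms by (auto intro: borel_compact borel_measurable_continuous_onI)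
  show ?thesis by measurable
qed

lemma set_integrable_hyperplane_measure:
  fixes \<nu> :: "real^'n" and g :: "real^'n \<Rightarrow> real"
  assumes F: "compact F" "continuous_on UNIV g" and n: "norm \<nu> = 1"
  shows "set_integrable (hyperplane_measure \<nu> c) F g"
proof -
  have nn: "\<nu> \<bullet> \<nu> = 1" using n by (simp add: dot_square_norm)
  obtain B R where *: "\<And>x. \<bar>indicator F x * g x\<bar> \<le> B" "\<And>x. indicator F x * g x \<noteq> 0 \<Longrightarrow> norm x \<le> R"
    using indicator_mult_bounds[OF F] by metis
  show ?thesis
    unfolding set_integrable_def real_scaleR_def
    using integrable_slab_projection[OF indicator_mult_borel[OF F], of \<nu> \<nu> B R c] nn *
    by (subst integrable_hyperplane_measure[OF indicator_mult_borel[OF F]]) simp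
qed

text \<open>This expresses a face integral as a volume integral of a function that is constant along the lines
parallel to \<open>e\<close>, times any weight; \<open>\<pi>\<close> is the projection along \<open>e\<close> to the hyperplane of the face.
The slab over the hyperplane, scaled by \<open>\<bar>\<nu> \<bullet> e\<bar>\<close>, is itself a weight, and averaging along lines shows
that all weights give the same value. Integrals over different faces thereby become integrals with
the same weight.\<close>

lemma face_integral_weighted:
  fixes \<nu> e :: "real^'n" and g :: "real^'n \<Rightarrow> real" and c :: real
  assumes F: "compact F" "continuous_on UNIV g" and n: "norm \<nu> = 1" and e: "\<nu> \<bullet> e \<noteq> 0"
    and w: "unit_weight e w"
  defines "\<pi> \<equiv> \<lambda>x. x - ((\<nu> \<bullet> x - c) / (\<nu> \<bullet> e)) *\<^sub>R e"
  shows "integrable lborel (\<lambda>x. w x * (indicator F (\<pi> x) * g (\<pi> x)))" (is ?I)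
    and "(\<integral>x. w x * (indicator F (\<pi> x) * g (\<pi> x)) \<partial>lborel) =
      \<bar>\<nu> \<bullet> e\<bar> * (LINT y:F|hyperplane_measure \<nu> c. g y)" (is ?E)
proof -
  define G where "G x = indicator F x * g x" for x
  have Gm [measurable]: "G \<in> borel_measurable borel"
    unfolding G_def by (rule indicator_mult_borel[OF F])
  have wm [measurable]: "w \<in> borel_measurable borel" and wp: "\<And>x. 0 \<le> w x"
    and w1: "\<And>x. (\<integral>\<^sup>+t. ennreal (w (x - t *\<^sub>R e)) \<partial>lborel) = 1"
    using w by (auto simp: unit_weight_def)
  define s where "s x = \<bar>\<nu> \<bullet> e\<bar> * indicator {y. c \<le> \<nu> \<bullet> y \<and> \<nu> \<bullet> y \<le> c + 1} x" for x
  have s: "unit_weight e s" unfolding s_def by (rule unit_weight_slab[OF e])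
  have [measurable]: "s \<in> borel_measurable borel" and sp: "\<And>x. 0 \<le> s x"
    and s1: "\<And>x. (\<integral>\<^sup>+t. ennreal (s (x - t *\<^sub>R e)) \<partial>lborel) = 1"
    using s by (auto simp: unit_weight_def)
  have s1': "(\<integral>\<^sup>+t. ennreal (s (x + t *\<^sub>R e)) \<partial>lborel) = 1" for x
    using nn_integral_real_affine[of "\<lambda>t. ennreal (s (x - t *\<^sub>R e))" "-1" 0] by (simp add: s1)
  have \<pi>inv: "\<pi> (x + t *\<^sub>R e) = \<pi> x" for x t
    using e by (simp add: \<pi>_def inner_add_right add_divide_distrib diff_divide_distrib scaleR_add_left scaleR_diff_left)
  have [measurable]: "\<pi> \<in> borel_measurable borel" unfolding \<pi>_def by measurable
  obtain B R where BR: "\<And>x. \<bar>G x\<bar> \<le> B" "\<And>x. G x \<noteq> 0 \<Longrightarrow> norm x \<le> R"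
    using indicator_mult_bounds[OF F] unfolding G_def by metis
  have Is: "integrable lborel (\<lambda>x. s x * G (\<pi> x))"
    using integrable_mult_right[OF integrable_slab_projection[OF Gm e BR, where c=c], of "\<bar>\<nu> \<bullet> e\<bar>"]
    by (simp add: s_def \<pi>_def mult.assoc)
  have "(\<integral>\<^sup>+x. ennreal \<bar>w x * G (\<pi> x)\<bar> \<partial>lborel)
      = (\<integral>\<^sup>+x. (\<integral>\<^sup>+t. ennreal (w x) * (ennreal \<bar>s (x + t *\<^sub>R e)\<bar> * ennreal \<bar>G (\<pi> x)\<bar>) \<partial>lborel) \<partial>lborel)"
    by (intro nn_integral_cong)
       (simp add: nn_integral_cmult nn_integral_multc sp s1' wp abs_mult ennreal_mult)
  also have "\<dots> = (\<integral>\<^sup>+x. ennreal \<bar>s x * G (\<pi> x)\<bar> \<partial>lborel)"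
    using nn_integral_along_lines[of "\<lambda>x. ennreal (w x)" "\<lambda>x. ennreal \<bar>s x * G (\<pi> x)\<bar>" e]
    by (simp add: w1 abs_mult ennreal_mult \<pi>inv)
  also have "\<dots> < \<infinity>"
    using Is by (simp add: integrable_iff_bounded)
  finally have "integrable lborel (\<lambda>x. w x * G (\<pi> x))"
    by (intro integrableI_bounded) simp_all
  then show ?I by (simp add: G_def)
  have s1'': "(\<integral>t. s (x + t *\<^sub>R e) \<partial>lborel) = 1" for x
    by (subst integral_eq_nn_integral) (simp_all add: sp s1')
  have "(\<integral>x. w x * G (\<pi> x) \<partial>lborel) = (\<integral>x. w x * (\<integral>t. s (x + t *\<^sub>R e) * G (\<pi> (x + t *\<^sub>R e)) \<partial>lborel) \<partial>lborel)"
    by (simp add: \<pi>inv s1'')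
  also have "\<dots> = (\<integral>x. s x * G (\<pi> x) \<partial>lborel)"
    by (rule integral_along_lines[OF Is w, symmetric])
  also have "\<dots> = \<bar>\<nu> \<bullet> e\<bar> * (\<integral>y. G y \<partial>hyperplane_measure \<nu> c)"
    unfolding integral_hyperplane_measure_oblique[OF Gm n e, where c=c]
    by (simp add: s_def \<pi>_def mult.assoc)
  finally show ?E by (simp add: G_def set_lebesgue_integral_def)
qed

section \<open>The divergence theorem on a simplex\<close>

lemma integrable_indicator_continuous:
  fixes g :: "real^'n \<Rightarrow> real"
  assumes "compact K" "continuous_on UNIV g"
  shows "integrable lborel (\<lambda>x. indicator K x * g x)"
  using borel_integrable_compact[OF assms(1) continuous_on_subset[OF assms(2)]]
  by (simp add: if_distrib indicator_def mult.commute cong: if_cong)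

text \<open>If \<open>e\<close> is parallel to all bounding hyperplanes but two, then every line parallel to \<open>e\<close> that meets
\<open>K\<close> enters through the face with \<open>\<nu> v \<bullet> e < 0\<close> and leaves through the one with \<open>\<nu> u \<bullet> e > 0\<close>, with no
exceptional lines. The fundamental theorem of calculus on each line turns the volume integral into
the difference of the values of \<open>f\<close> at the exit and entry points, and
\<open>face_integral_weighted\<close> reads these as face integrals.\<close>

lemma directional_divergence:
  fixes K :: "(real^'n) set" and \<nu> :: "'i \<Rightarrow> real^'n" and e :: "real^'n"
  assumes I: "finite I" and K: "compact K" "K = {x. \<forall>i\<in>I. \<nu> i \<bullet> x \<le> c i}"
    and n: "\<And>i. i \<in> I \<Longrightarrow> norm (\<nu> i) = 1"
    and u: "u \<in> I" "\<nu> u \<bullet> e > 0" and v: "v \<in> I" "\<nu> v \<bullet> e < 0"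
    and others: "\<And>i. i \<in> I \<Longrightarrow> i \<noteq> u \<Longrightarrow> i \<noteq> v \<Longrightarrow> \<nu> i \<bullet> e = 0"
    and f: "\<And>x. (f has_derivative f' x) (at x)" and f': "continuous_on UNIV (\<lambda>x. f' x e)"
  shows "(\<integral>x. indicator K x * f' x e \<partial>lborel) =
    (\<Sum>i\<in>I. (\<nu> i \<bullet> e) * (LINT y:K \<inter> {x. \<nu> i \<bullet> x = c i}|hyperplane_measure (\<nu> i) (c i). f y))"
proof -
  have uv: "u \<noteq> v" using u v by auto
  have fc: "continuous_on UNIV f"
    using f by (meson continuous_at_imp_continuous_on has_derivative_continuous)
  define F where "F i = K \<inter> {x. \<nu> i \<bullet> x = c i}" for i
  have Fc: "compact (F i)" for i
    unfolding F_def by (intro compact_Int_closed K closed_hyperplane)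
  \<comment> \<open>The point of the line \<open>x + t e\<close> on the \<open>i\<close>-th hyperplane (with
    \<open>i\<close> one of \<open>u\<close>, \<open>v\<close>) is at parameter \<open>\<tau> i x\<close>; it
    is \<open>\<pi> i x\<close>.\<close>
  define \<tau> where "\<tau> i x = - ((\<nu> i \<bullet> x - c i) / (\<nu> i \<bullet> e))" for i x
  define \<pi> where "\<pi> i x = x - ((\<nu> i \<bullet> x - c i) / (\<nu> i \<bullet> e)) *\<^sub>R e" for i x
  have \<pi>\<tau>: "\<pi> i x = x + \<tau> i x *\<^sub>R e" for i x
    by (simp add: \<pi>_def \<tau>_def)
  define w where "w x = \<bar>\<nu> u \<bullet> e\<bar> * indicator {y. 0 \<le> \<nu> u \<bullet> y \<and> \<nu> u \<bullet> y \<le> 0 + 1} x" for x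
  have w: "unit_weight e w" unfolding w_def by (rule unit_weight_slab) (use u in simp)
  have slice: "(\<integral>t. indicator K (x + t *\<^sub>R e) * f' (x + t *\<^sub>R e) e \<partial>lborel)
      = indicator (F u) (\<pi> u x) * f (\<pi> u x) - indicator (F v) (\<pi> v x) * f (\<pi> v x)" for x
  proof -
    define Q where "Q \<longleftrightarrow> (\<forall>i\<in>I - {u, v}. \<nu> i \<bullet> x \<le> c i)"
    have inK: "x + t *\<^sub>R e \<in> K \<longleftrightarrow> Q \<and> \<tau> v x \<le> t \<and> t \<le> \<tau> u x" for t
    proof -
      have "x + t *\<^sub>R e \<in> K \<longleftrightarrow> Q \<and> \<nu> u \<bullet> (x + t *\<^sub>R e) \<le> c u \<and> \<nu> v \<bullet> (x + t *\<^sub>R e) \<le> c v"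
      proof -
        have "\<nu> i \<bullet> (x + t *\<^sub>R e) = \<nu> i \<bullet> x" if "i \<in> I - {u, v}" for i
          using others[of i] that by (simp add: inner_add_right)
        moreover have "I = I - {u, v} \<union> {u, v}" using u v by auto
        ultimately show ?thesis unfolding K(2) Q_def by (smt (verit) Un_iff insert_iff mem_Collect_eq singletonD)
      qed
      also have "\<nu> u \<bullet> (x + t *\<^sub>R e) \<le> c u \<longleftrightarrow> t \<le> \<tau> u x"
        using u by (simp add: \<tau>_def inner_add_right field_simps)
      also have "\<nu> v \<bullet> (x + t *\<^sub>R e) \<le> c v \<longleftrightarrow> \<tau> v x \<le> t"
        using v by (simp add: \<tau>_def inner_add_right field_simps)
      finally show ?thesis by auto
    qed
    have pl: "\<nu> i \<bullet> (x + \<tau> i x *\<^sub>R e) = c i" if "\<nu> i \<bullet> e \<noteq> 0" for i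
      using that by (simp add: \<tau>_def inner_diff_right)
    have Fu: "\<pi> u x \<in> F u \<longleftrightarrow> Q \<and> \<tau> v x \<le> \<tau> u x"
      unfolding F_def \<pi>\<tau> using inK[of "\<tau> u x"] pl[of u] u by auto
    have Fv: "\<pi> v x \<in> F v \<longleftrightarrow> Q \<and> \<tau> v x \<le> \<tau> u x"
      unfolding F_def \<pi>\<tau> using inK[of "\<tau> v x"] pl[of v] v by auto
    show ?thesis
    proof (cases "Q \<and> \<tau> v x \<le> \<tau> u x")
      case True
      have "(\<integral>t. f' (x + t *\<^sub>R e) e * indicator {\<tau> v x..\<tau> u x} t \<partial>lborel) = f (x + \<tau> u x *\<^sub>R e) - f (x + \<tau> v x *\<^sub>R e)"
      proof (rule integral_FTC_Icc_real)
        show "\<tau> v x \<le> \<tau> u x" using True by simp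
        fix t :: real
        have "((\<lambda>t. x + t *\<^sub>R e) has_derivative (\<lambda>t. t *\<^sub>R e)) (at t)"
          by (auto intro!: derivative_eq_intros)
        from has_derivative_compose[OF this f]
        have "((\<lambda>t. f (x + t *\<^sub>R e)) has_derivative (\<lambda>h. f' (x + t *\<^sub>R e) (h *\<^sub>R e))) (at t)" .
        moreover have "f' (x + t *\<^sub>R e) (h *\<^sub>R e) = f' (x + t *\<^sub>R e) e * h" for h
          using has_derivative_linear[OF f] by (simp add: linear_scale)
        ultimately show "((\<lambda>t. f (x + t *\<^sub>R e)) has_real_derivative f' (x + t *\<^sub>R e) e) (at t)"
          by (simp add: has_field_derivative_def)
        have "continuous_on UNIV (\<lambda>t. f' (x + t *\<^sub>R e) e)"
          by (rule continuous_on_compose2[OF f']) (auto intro!: continuous_intros)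
        then show "isCont (\<lambda>t. f' (x + t *\<^sub>R e) e) t"
          by (simp add: continuous_on_eq_continuous_at)
      qed
      moreover have "indicator K (x + t *\<^sub>R e) * f' (x + t *\<^sub>R e) e = f' (x + t *\<^sub>R e) e * indicator {\<tau> v x..\<tau> u x} t" for t
        using True inK[of t] by (auto simp: indicator_def)
      ultimately show ?thesis using True Fu Fv by (simp only: \<pi>\<tau> indicator_simps mult_1)
    next
      case False
      then have "indicator K (x + t *\<^sub>R e) = (0::real)" for t
        using inK[of t] by (auto simp: indicator_def)
      then show ?thesis using False Fu Fv by simp
    qed
  qed
  note fu = face_integral_weighted[OF Fc fc n[OF u(1)] _ w, of u "c u", folded \<pi>_def]
  note fv = face_integral_weighted[OF Fc fc n[OF v(1)] _ w, of v "c v", folded \<pi>_def]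
  have "(\<integral>x. indicator K x * f' x e \<partial>lborel)
      = (\<integral>x. w x * (\<integral>t. indicator K (x + t *\<^sub>R e) * f' (x + t *\<^sub>R e) e \<partial>lborel) \<partial>lborel)"
    by (rule integral_along_lines[OF integrable_indicator_continuous[OF K(1) f'] w])
  also have "\<dots> = (\<integral>x. w x * (indicator (F u) (\<pi> u x) * f (\<pi> u x)) - w x * (indicator (F v) (\<pi> v x) * f (\<pi> v x)) \<partial>lborel)"
    by (simp add: slice right_diff_distrib)
  also have "\<dots> = (\<integral>x. w x * (indicator (F u) (\<pi> u x) * f (\<pi> u x)) \<partial>lborel)
      - (\<integral>x. w x * (indicator (F v) (\<pi> v x) * f (\<pi> v x)) \<partial>lborel)"
    by (rule Bochner_Integration.integral_diff) (use fu(1) fv(1) u v in auto)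
  also have "\<dots> = (\<nu> u \<bullet> e) * (LINT y:F u|hyperplane_measure (\<nu> u) (c u). f y)
      + (\<nu> v \<bullet> e) * (LINT y:F v|hyperplane_measure (\<nu> v) (c v). f y)"
    using fu(2) fv(2) u v by simp
  also have "\<dots> = (\<Sum>i\<in>{u, v}. (\<nu> i \<bullet> e) * (LINT y:F i|hyperplane_measure (\<nu> i) (c i). f y))"
    using uv by simp
  also have "\<dots> = (\<Sum>i\<in>I. (\<nu> i \<bullet> e) * (LINT y:F i|hyperplane_measure (\<nu> i) (c i). f y))"
    by (rule sum.mono_neutral_left) (use I u v others in auto)
  finally show ?thesis by (simp add: F_def)
qed

text \<open>The offset of the hyperplane, existentially quantified in \<^const>\<open>outward_normal\<close>, in the form in
which \<^const>\<open>face_measure\<close> refers to it.\<close>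

lemma outward_normalD:
  assumes "outward_normal K F \<nu>" "F \<noteq> {}"
  shows "norm \<nu> = 1" "\<And>x. x \<in> K \<Longrightarrow> \<nu> \<bullet> x \<le> \<nu> \<bullet> (SOME x. x \<in> F)"
    "F = K \<inter> {x. \<nu> \<bullet> x = \<nu> \<bullet> (SOME x. x \<in> F)}"
proof -
  obtain c where c: "norm \<nu> = 1" "\<forall>x\<in>K. \<nu> \<bullet> x \<le> c" "F = K \<inter> {x. \<nu> \<bullet> x = c}"
    using assms by (auto simp: outward_normal_def)
  have "(SOME x. x \<in> F) \<in> F" using assms(2) by (simp add: some_in_eq)
  then have "\<nu> \<bullet> (SOME x. x \<in> F) = c" using c(3) by auto
  with c show "norm \<nu> = 1" "\<And>x. x \<in> K \<Longrightarrow> \<nu> \<bullet> x \<le> \<nu> \<bullet> (SOME x. x \<in> F)"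
    "F = K \<inter> {x. \<nu> \<bullet> x = \<nu> \<bullet> (SOME x. x \<in> F)}" by auto
qed

lemma facet_of_imp_nonempty: "F facet_of K \<Longrightarrow> F \<noteq> {}"
  by (simp add: facet_of_def)

text \<open>Along the edge from vertex \<open>u\<close> to vertex \<open>v\<close> of a simplex, \<open>directional_divergence\<close> applies: the
edge lies in every facet except the two opposite to \<open>u\<close> and \<open>v\<close>. Both sides are linear in the
direction \<open>e\<close>, and the edge directions span the space.\<close>

lemma simplex_divergence:
  fixes K :: "(real^'n) set" and \<nu> :: "(real^'n) set \<Rightarrow> real^'n"
  assumes K: "int CARD('n) simplex K"
    and \<nu>: "\<And>F. F facet_of K \<Longrightarrow> outward_normal K F (\<nu> F)"
    and f: "\<And>x. (f has_derivative f' x) (at x)" and f': "\<And>e. continuous_on UNIV (\<lambda>x. f' x e)"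
  shows "(\<integral>x. indicator K x * f' x e \<partial>lborel) =
    (\<Sum>F | F facet_of K. (\<nu> F \<bullet> e) *
      (LINT y:F|hyperplane_measure (\<nu> F) (\<nu> F \<bullet> (SOME x. x \<in> F)). f y))"
proof -
  obtain C where C: "\<not> affine_dependent C" "int (card C) = int CARD('n) + 1" "K = convex hull C"
    using K by (auto simp: simplex_def)
  have finC: "finite C" using C(1) aff_independent_finite by blast
  have cC: "2 \<le> card C"
    using C(2) zero_less_card_finite[where 'a='n] by linarith
  have KC: "compact K" using K compact_simplex by blast
  define c where "c F = \<nu> F \<bullet> (SOME x. x \<in> F)" for F
  define I where "I = {F. F facet_of K}"
  define \<Phi> where "\<Phi> w = convex hull (C - {w})" for w
  have I: "I = \<Phi> ` C"
    unfolding I_def C(3) \<Phi>_def using facet_of_convex_hull_affine_independent_alt[OF C(1)] cC by auto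
  have fin: "finite I" using I finC by simp
  have nF: "norm (\<nu> F) = 1" and leF: "\<And>x. x \<in> K \<Longrightarrow> \<nu> F \<bullet> x \<le> c F"
    and eqF: "F = K \<inter> {x. \<nu> F \<bullet> x = c F}" if "F \<in> I" for F
    using outward_normalD[OF \<nu>[of F]] that facet_of_imp_nonempty[of F K] unfolding I_def c_def by auto
  have CK: "C \<subseteq> K" using C(3) hull_subset by metis
  have Ceq: "\<nu> (\<Phi> w) \<bullet> v = c (\<Phi> w)" if "w \<in> C" "v \<in> C" "v \<noteq> w" for v w
  proof -
    have "v \<in> \<Phi> w" unfolding \<Phi>_def using that by (auto intro: hull_inc)
    then show ?thesis using eqF[of "\<Phi> w"] I that by auto
  qed
  have Clt: "\<nu> (\<Phi> w) \<bullet> w < c (\<Phi> w)" if w: "w \<in> C" for w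
  proof -
    have "w \<notin> affine hull (C - {w})" using C(1) w by (auto simp: affine_dependent_def)
    then have "w \<notin> \<Phi> w" using convex_hull_subset_affine_hull unfolding \<Phi>_def by blast
    then have "\<nu> (\<Phi> w) \<bullet> w \<noteq> c (\<Phi> w)" using eqF[of "\<Phi> w"] I w CK by auto
    then show ?thesis using leF[of "\<Phi> w" w] I w CK by force
  qed
  have "aff_dim C = int DIM(real^'n)" 
    using aff_dim_affine_independent[OF C(1)] C(2) by simp
  then have "affine hull C = UNIV" using aff_dim_eq_full by blast
  then have bary: "\<exists>l. sum l C = 1 \<and> (\<Sum>w\<in>C. l w *\<^sub>R w) = x" for x
    using affine_hull_finite[OF finC] by auto
  have Khalf: "K = {x. \<forall>F\<in>I. \<nu> F \<bullet> x \<le> c F}"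
  proof (intro equalityI subsetI)
    fix x assume x: "x \<in> {x. \<forall>F\<in>I. \<nu> F \<bullet> x \<le> c F}"
    obtain l where l: "sum l C = 1" "(\<Sum>w\<in>C. l w *\<^sub>R w) = x" using bary by blast
    \<comment> \<open>The distance to a facet is a positive multiple of the barycentric coordinate of the
      opposite vertex.\<close>
    have "0 \<le> l w" if w: "w \<in> C" for w
    proof -
      have "\<nu> (\<Phi> w) \<bullet> x = (\<Sum>v\<in>C. l v * (\<nu> (\<Phi> w) \<bullet> v))"
        by (simp add: l(2)[symmetric] inner_sum_right)
      also have "\<dots> = l w * (\<nu> (\<Phi> w) \<bullet> w) + (\<Sum>v\<in>C - {w}. l v * c (\<Phi> w))"
        using w Ceq[OF w] by (simp add: sum.remove[OF finC w])
      also have "(\<Sum>v\<in>C - {w}. l v * c (\<Phi> w)) = (1 - l w) * c (\<Phi> w)"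
        using l(1) sum.remove[OF finC w, of l] by (simp add: sum_distrib_right[symmetric])
      finally have "\<nu> (\<Phi> w) \<bullet> x = c (\<Phi> w) - l w * (c (\<Phi> w) - \<nu> (\<Phi> w) \<bullet> w)"
        by (simp add: algebra_simps)
      moreover have "\<nu> (\<Phi> w) \<bullet> x \<le> c (\<Phi> w)" using x w I by auto
      ultimately have "0 \<le> l w * (c (\<Phi> w) - \<nu> (\<Phi> w) \<bullet> w)" by simp
      then show ?thesis using Clt[OF w] by (simp add: zero_le_mult_iff)
    qed
    then show "x \<in> K" unfolding C(3) convex_hull_finite[OF finC] using l by auto
  qed (use leF in auto)
  have inj: "\<Phi> v = \<Phi> w \<longleftrightarrow> v = w" if "v \<in> C" "w \<in> C" for v w
    using Ceq[of v w] Clt[of w] that by fastforce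
  define D where "D e = (\<integral>x. indicator K x * f' x e \<partial>lborel) -
    (\<Sum>F\<in>I. (\<nu> F \<bullet> e) * (LINT y:F|hyperplane_measure (\<nu> F) (c F). f y))" for e
  have edge: "D (v - u) = 0" if u: "u \<in> C" and v: "v \<in> C" for u v
  proof (cases "u = v")
    case True
    have "f' x 0 = 0" for x using f linear_0 has_derivative_linear by blast
    then show ?thesis using True by (simp add: D_def)
  next
    case False
    have "(\<integral>x. indicator K x * f' x (v - u) \<partial>lborel) =
      (\<Sum>F\<in>I. (\<nu> F \<bullet> (v - u)) * (LINT y:K \<inter> {x. \<nu> F \<bullet> x = c F}|hyperplane_measure (\<nu> F) (c F). f y))"
    proof (rule directional_divergence[OF fin KC Khalf nF _ _ _ _ _ f f'])
      show "\<Phi> u \<in> I" "\<Phi> v \<in> I" using u v I by auto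
      show "0 < \<nu> (\<Phi> u) \<bullet> (v - u)" "\<nu> (\<Phi> v) \<bullet> (v - u) < 0"
        using Ceq Clt False u v by (auto simp: inner_diff_right)
      fix F assume "F \<in> I" "F \<noteq> \<Phi> u" "F \<noteq> \<Phi> v"
      then obtain w where "w \<in> C" "F = \<Phi> w" "w \<noteq> u" "w \<noteq> v" using I by auto
      then show "\<nu> F \<bullet> (v - u) = 0" using Ceq u v by (auto simp: inner_diff_right)
    qed simp
    also have "\<dots> = (\<Sum>F\<in>I. (\<nu> F \<bullet> (v - u)) * (LINT y:F|hyperplane_measure (\<nu> F) (c F). f y))"
      by (intro sum.cong refl) (simp flip: eqF)
    finally show ?thesis by (simp add: D_def)
  qed
  have "linear D"
  proof (rule linearI)
    note lin = has_derivative_linear[OF f]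
    note int = integrable_indicator_continuous[OF KC f']
    fix a b
    show "D (a + b) = D a + D b"
      unfolding D_def
      by (simp add: linear_add[OF lin] inner_add_right ring_distribs sum.distrib Bochner_Integration.integral_add[OF int int])
  next
    note lin = has_derivative_linear[OF f]
    fix r a
    show "D (r *\<^sub>R a) = r *\<^sub>R D a"
      unfolding D_def
      by (simp add: linear_scale[OF lin] mult.left_commute mult.assoc sum_distrib_left right_diff_distrib)
  qed
  have "C \<noteq> {}" using cC by auto
  then obtain u where u: "u \<in> C" by blast
  obtain l where l: "sum l C = 1" "(\<Sum>w\<in>C. l w *\<^sub>R w) = u + e" using bary by blast
  have "(\<Sum>w\<in>C. l w *\<^sub>R (w - u)) = e"
    using l by (simp add: scaleR_diff_right sum_subtractf flip: scaleR_left.sum)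
  then have "D e = (\<Sum>w\<in>C. l w *\<^sub>R D (w - u))"
    using \<open>linear D\<close> by (metis (no_types, lifting) linear_scale linear_sum sum.cong)
  also have "\<dots> = 0" using edge u by simp
  finally show ?thesis by (simp add: D_def I_def c_def)
qed

section \<open>Faces and their adjacent elements\<close>

lemma simplex_full_interior:
  fixes K :: "(real^'n) set"
  assumes "int CARD('n) simplex K"
  shows "interior K \<noteq> {}" "aff_dim K = int CARD('n)" "convex K" "compact K"
proof -
  show ad: "aff_dim K = int CARD('n)" "convex K" "compact K"
    using assms aff_dim_simplex convex_simplex compact_simplex by auto
  then have "affine hull K = UNIV" using aff_dim_eq_full[of K] by simp
  then have "rel_interior K = interior K" using rel_interior_interior by blast
  moreover have "K \<noteq> {}" using ad by auto
  ultimately show "interior K \<noteq> {}" using rel_interior_eq_empty ad by metis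
qed

lemma facet_affine_hull:
  fixes K :: "(real^'n) set"
  assumes K: "int CARD('n) simplex K" and F: "F facet_of K" and n: "\<nu> \<noteq> 0" "\<And>x. x \<in> F \<Longrightarrow> \<nu> \<bullet> x = c"
  shows "affine hull F = {x. \<nu> \<bullet> x = c}"
proof (rule affine_dim_equal)
  show "affine (affine hull F)" "affine {x. \<nu> \<bullet> x = c}" by (auto simp: affine_hyperplane)
  show "affine hull F \<noteq> {}" using F by (simp add: facet_of_def)
  show "affine hull F \<subseteq> {x. \<nu> \<bullet> x = c}"
    using n by (intro hull_minimal) (auto simp: affine_hyperplane)
  have "aff_dim F = int CARD('n) - 1" using F simplex_full_interior(2)[OF K] by (simp add: facet_of_def)
  then show "aff_dim (affine hull F) = aff_dim {x. \<nu> \<bullet> x = c}"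
    using n by (simp add: aff_dim_hyperplane)
qed

text \<open>A facet spans its hyperplane, which determines the unit normal up to sign.\<close>

lemma outward_normal_or_opposite:
  fixes K :: "(real^'n) set"
  assumes K: "int CARD('n) simplex K" and F: "F facet_of K" and n: "norm \<nu> = 1" "\<And>x. x \<in> F \<Longrightarrow> \<nu> \<bullet> x = c"
  shows "outward_normal K F \<nu> \<or> outward_normal K F (- \<nu>)"
proof -
  obtain a' b' where a': "a' \<noteq> 0" "K \<subseteq> {x. a' \<bullet> x \<le> b'}" "F = K \<inter> {x. a' \<bullet> x = b'}"
    using facet_of_polyhedron[OF simplex_imp_polyhedron[OF K] F] by metis
  define a b where "a = a' /\<^sub>R norm a'" and "b = b' / norm a'"
  have a: "norm a = 1" "K \<subseteq> {x. a \<bullet> x \<le> b}" "F = K \<inter> {x. a \<bullet> x = b}"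
    using a' by (auto simp: a_def b_def divide_simps mult.commute)
  have "affine hull F = {x. \<nu> \<bullet> x = c}" by (rule facet_affine_hull[OF K F]) (use n in auto)
  moreover have "affine hull F = {x. a \<bullet> x = b}" by (rule facet_affine_hull[OF K F]) (use a in auto)
  ultimately have eq: "{x. \<nu> \<bullet> x = c} = {x. a \<bullet> x = b}" by simp
  obtain p where p: "p \<in> F" using F facet_of_imp_nonempty by blast
  have nn: "\<nu> \<bullet> \<nu> = 1" "a \<bullet> a = 1" using n a by (auto simp: dot_square_norm)
  \<comment> \<open>The part of \<open>a\<close> orthogonal to \<open>\<nu>\<close> is parallel to the
    hyperplane, hence also orthogonal to \<open>a\<close>.\<close>
  define d where "d = a - (a \<bullet> \<nu>) *\<^sub>R \<nu>"
  have "\<nu> \<bullet> d = 0" by (simp add: d_def inner_diff_right nn inner_commute)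
  then have "p + d \<in> {x. \<nu> \<bullet> x = c}" using n p by (simp add: inner_add_right)
  then have "a \<bullet> d = 0" using eq p a(3) by (auto simp: inner_add_right)
  with \<open>\<nu> \<bullet> d = 0\<close> have "d \<bullet> d = 0" by (simp add: d_def inner_diff_left)
  then have ad: "a = (a \<bullet> \<nu>) *\<^sub>R \<nu>" by (simp add: d_def)
  then have "\<bar>a \<bullet> \<nu>\<bar> = 1" using a n by (metis mult.right_neutral norm_scaleR)
  then have "a = \<nu> \<or> a = - \<nu>" using ad by (metis abs_eq_iff abs_one scaleR_minus_left scaleR_one)
  moreover have "outward_normal K F a" unfolding outward_normal_def using a by auto
  ultimately show ?thesis by auto
qed

text \<open>Near a relative interior point \<open>p\<close> of the common facet, both simplices fill the same half of a ball.\<close>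

lemma same_side_interiors_meet:
  fixes K1 K2 :: "(real^'n) set"
  assumes K1: "int CARD('n) simplex K1" and K2: "int CARD('n) simplex K2"
    and F1: "F facet_of K1" and F2: "F facet_of K2"
    and n1: "outward_normal K1 F \<nu>" and n2: "outward_normal K2 F \<nu>"
  shows "interior K1 \<inter> K2 \<noteq> {}"
proof -
  define c where "c = \<nu> \<bullet> (SOME x. x \<in> F)"
  note o1 = outward_normalD[OF n1 facet_of_imp_nonempty[OF F1], folded c_def]
  note o2 = outward_normalD[OF n2 facet_of_imp_nonempty[OF F2], folded c_def]
  have below: "\<exists>y. y \<in> interior K \<and> \<nu> \<bullet> y < c"
    if K: "int CARD('n) simplex K" "F facet_of K" "\<And>x. x \<in> K \<Longrightarrow> \<nu> \<bullet> x \<le> c" "F = K \<inter> {x. \<nu> \<bullet> x = c}" for K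
  proof -
    obtain y where y: "y \<in> interior K" using simplex_full_interior(1)[OF K(1)] by blast
    have "F face_of K" "F \<noteq> K" using K(2) facet_of_imp_face_of facet_of_irrefl by blast+
    then have "F \<inter> interior K = {}" by (rule face_of_disjoint_interior)
    then have "\<nu> \<bullet> y \<noteq> c" using y K(4) interior_subset by blast
    then have "\<nu> \<bullet> y < c" using K(3)[of y] y interior_subset by force
    then show ?thesis using y by blast
  qed
  obtain y1 where y1: "y1 \<in> interior K1" "\<nu> \<bullet> y1 < c" using below[OF K1 F1 o1(2,3)] by blast
  obtain y2 where y2: "y2 \<in> interior K2" "\<nu> \<bullet> y2 < c" using below[OF K2 F2 o2(2,3)] by blast
  have H: "affine hull F = {x. \<nu> \<bullet> x = c}"
    by (rule facet_affine_hull[OF K1 F1]) (use o1 in auto)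
  have cF: "convex F" using F1 facet_of_imp_face_of face_of_imp_convex by blast
  then obtain p where p: "p \<in> rel_interior F"
    using rel_interior_eq_empty[OF cF] facet_of_imp_nonempty[OF F1] by blast
  then obtain \<epsilon> where e: "\<epsilon> > 0" "ball p \<epsilon> \<inter> affine hull F \<subseteq> F" and pF: "p \<in> F"
    by (auto simp: mem_rel_interior_ball)
  have pc: "\<nu> \<bullet> p = c" using pF o1 by auto
  \<comment> \<open>With steps in the ratio \<open>q\<close>, moving from \<open>p\<close> towards
    \<open>y1\<close> and towards \<open>y2\<close> gains the same distance from the hyperplane.\<close>
  define q where "q = (c - \<nu> \<bullet> y2) / (c - \<nu> \<bullet> y1)"
  have q: "q > 0" using y1 y2 by (simp add: q_def)
  \<comment> \<open>The point \<open>z\<close> below is at \<open>r * q\<close> between \<open>p\<close> and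
    \<open>y1\<close>, and also at \<open>r\<close> between \<open>\<phi> r\<close> and \<open>y2\<close>; as
    \<open>r\<close> tends to 0, \<open>\<phi> r\<close> tends to \<open>p\<close> within the hyperplane, so
    it is in the facet.\<close>
  define \<phi> where "\<phi> r = (1 / (1 - r)) *\<^sub>R (p + (r * q) *\<^sub>R (y1 - p) - r *\<^sub>R y2)" for r :: real
  have "(\<phi> \<longlongrightarrow> (1 / (1 - 0)) *\<^sub>R (p + (0 * q) *\<^sub>R (y1 - p) - 0 *\<^sub>R y2)) (at_right 0)"
    unfolding \<phi>_def by (intro tendsto_intros) simp_all
  then have "(\<phi> \<longlongrightarrow> p) (at_right 0)" by simp
  then have "eventually (\<lambda>r. dist (\<phi> r) p < \<epsilon>) (at_right 0)" using e(1) by (rule tendstoD)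
  moreover have "eventually (\<lambda>r. r \<in> {0<..<min (1/2) (1/q)}) (at_right (0::real))"
    by (rule eventually_at_right_real) (use q in simp)
  ultimately have "eventually (\<lambda>r. dist (\<phi> r) p < \<epsilon> \<and> r \<in> {0<..<min (1/2) (1/q)}) (at_right 0)"
    by (rule eventually_conj)
  then obtain r where r: "dist (\<phi> r) p < \<epsilon>" "0 < r" "r < 1/2" "r < 1/q"
    using eventually_happens'[of "at_right (0::real)"] by auto
  have rq: "r * q \<le> 1" "0 < r * q" using r q by (auto simp: field_simps)
  have "\<nu> \<bullet> (p + (r * q) *\<^sub>R (y1 - p) - r *\<^sub>R y2) = (1 - r) * c"
  proof -
    have "q * (\<nu> \<bullet> y1 - c) = - (c - \<nu> \<bullet> y2)" using y1 by (simp add: q_def field_simps)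
    then show ?thesis by (simp add: inner_add_right inner_diff_right pc mult.assoc) (simp add: algebra_simps)
  qed
  then have "\<nu> \<bullet> \<phi> r = c" using r by (simp add: \<phi>_def)
  then have \<phi>F: "\<phi> r \<in> F" using e(2) H r(1) by (auto simp: dist_commute)
  define z where "z = p - (r * q) *\<^sub>R (p - y1)"
  have "z = (1 - r) *\<^sub>R \<phi> r + r *\<^sub>R y2"
  proof -
    have "(1 - r) *\<^sub>R \<phi> r = p + (r * q) *\<^sub>R (y1 - p) - r *\<^sub>R y2"
      using r by (simp add: \<phi>_def)
    then show ?thesis by (simp add: z_def algebra_simps)
  qed
  moreover have "\<phi> r \<in> K2" "y2 \<in> K2" using \<phi>F o2 y2 interior_subset by blast+
  ultimately have "z \<in> K2"
    using simplex_full_interior(3)[OF K2] r by (simp add: convexD_alt)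
  moreover have "z \<in> interior K1"
    unfolding z_def by (rule mem_interior_convex_shrink) (use simplex_full_interior(3)[OF K1] y1 pF o1 rq in auto)
  ultimately show ?thesis by blast
qed

lemma interior_faces_subset: "interior_faces M \<subseteq> faces M"
  by (auto simp: faces_def interior_faces_def)

context
  fixes M :: "('n::finite) mesh"
  assumes mesh: "simplicial_mesh M"
begin

lemma elem_simplex: "K \<in> elems M \<Longrightarrow> int CARD('n) simplex K"
  using mesh by (simp add: simplicial_mesh_def)

lemmas elem_props = simplex_full_interior[OF elem_simplex]

lemma finite_elems: "finite (elems M)"
  using mesh by (simp add: simplicial_mesh_def triangulation_def)

lemma finite_facets: "K \<in> elems M \<Longrightarrow> finite {F. F facet_of K}"
  using elem_simplex simplex_imp_polytope finite_polytope_facets by blast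

lemma finite_faces: "finite (faces M)"
proof -
  have "faces M = (\<Union>K\<in>elems M. {F. F facet_of K})" by (auto simp: faces_def)
  then show ?thesis using finite_elems finite_facets by simp
qed

lemma elems_face_to_face: "K \<in> elems M \<Longrightarrow> K' \<in> elems M \<Longrightarrow> (K \<inter> K') face_of K"
  using mesh by (simp add: simplicial_mesh_def triangulation_def)

lemma elem_subset_eq:
  assumes "K \<in> elems M" "K' \<in> elems M" "K \<subseteq> K'"
  shows "K = K'"
proof (rule ccontr)
  assume "K \<noteq> K'"
  moreover have "K' \<inter> K face_of K'" using elems_face_to_face assms by blast
  moreover have "K' \<inter> K = K" using assms by blast
  ultimately have "aff_dim K < aff_dim K'" using face_of_aff_dim_lt elem_props(3) assms by metis
  then show False using elem_props(2) assms by simp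
qed

lemma elem_interior_disjoint:
  assumes "K \<in> elems M" "K' \<in> elems M" "K \<noteq> K'"
  shows "interior K \<inter> K' = {}"
proof (rule ccontr)
  assume "interior K \<inter> K' \<noteq> {}"
  then have "(K \<inter> K') \<inter> interior K \<noteq> {}" using interior_subset by blast
  then have "K \<inter> K' = K" using face_of_disjoint_interior elems_face_to_face assms by blast
  then show False using elem_subset_eq assms by blast
qed

lemma same_normal_eq:
  assumes "K \<in> elems M" "K' \<in> elems M" "F facet_of K" "F facet_of K'"
    "outward_normal K F \<nu>" "outward_normal K' F \<nu>"
  shows "K = K'"
  using same_side_interiors_meet[of K K' F \<nu>] elem_interior_disjoint assms elem_simplex by metis

text \<open>The definite description is meaningful because two elements cannot lie on the same side of a common
facet.\<close>

lemma K_plus: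
  assumes "F \<in> faces M"
  shows "K_plus M F \<in> elems M" "F facet_of K_plus M F" "outward_normal (K_plus M F) F (nrm M F)"
proof -
  have "\<exists>!K. K \<in> elems M \<and> F facet_of K \<and> outward_normal K F (nrm M F)"
    using mesh assms same_normal_eq unfolding simplicial_mesh_def by blast
  from theI'[OF this, folded K_plus_def]
  show "K_plus M F \<in> elems M" "F facet_of K_plus M F" "outward_normal (K_plus M F) F (nrm M F)" by auto
qed

lemma nrm_unit: "F \<in> faces M \<Longrightarrow> norm (nrm M F) = 1"
  using K_plus(3) by (auto simp: outward_normal_def)

lemma outward_normal_other:
  assumes "K \<in> elems M" "F facet_of K" "K \<noteq> K_plus M F"
  shows "outward_normal K F (- nrm M F)"
proof -
  have F: "F \<in> faces M" using assms by (auto simp: faces_def)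
  note o = outward_normalD[OF K_plus(3)[OF F] facet_of_imp_nonempty[OF assms(2)]]
  have "outward_normal K F (nrm M F) \<or> outward_normal K F (- nrm M F)"
    by (rule outward_normal_or_opposite[OF elem_simplex[OF assms(1)] assms(2) o(1)]) (use o(3) in blast)
  then show ?thesis using same_normal_eq[OF assms(1) K_plus(1)[OF F] assms(2) K_plus(2)[OF F] _ K_plus(3)[OF F]] assms(3)
    by blast
qed

lemma K_minus:
  assumes F: "F \<in> interior_faces M"
  shows "K_minus M F \<in> elems M" "F facet_of K_minus M F" "K_minus M F \<noteq> K_plus M F"
    "{K \<in> elems M. F facet_of K} = {K_plus M F, K_minus M F}"
proof -
  have "F \<in> faces M" using F interior_faces_subset by blast
  note Kp = K_plus[OF this]
  obtain K where K: "K \<in> elems M" "F facet_of K" "K \<noteq> K_plus M F"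
    using F Kp unfolding interior_faces_def by blast
  have uniq: "K' = K" if "K' \<in> elems M" "F facet_of K'" "K' \<noteq> K_plus M F" for K'
    using same_normal_eq that K outward_normal_other by blast
  have eq: "K_minus M F = K"
    unfolding K_minus_def using K uniq by (intro the_equality) blast+
  show "K_minus M F \<in> elems M" "F facet_of K_minus M F" "K_minus M F \<noteq> K_plus M F"
    unfolding eq by (fact K)+
  show "{K \<in> elems M. F facet_of K} = {K_plus M F, K_minus M F}"
    unfolding eq using K(1,2) Kp(1,2) uniq by blast
qed

lemma exterior_face_elems:
  assumes "F \<in> faces M" "F \<notin> interior_faces M"
  shows "{K \<in> elems M. F facet_of K} = {K_plus M F}"
  using K_plus[OF assms(1)] assms(2) unfolding interior_faces_def by blast

lemma elem_subset_closure: "K \<in> elems M \<Longrightarrow> K \<subseteq> closure (region M)"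
  using mesh unfolding simplicial_mesh_def by blast

lemma open_region: "open (region M)"
  and interior_closure_region: "interior (closure (region M)) = region M"
  and Union_elems: "\<Union>(elems M) = closure (region M)"
  using mesh by (auto simp: simplicial_mesh_def polyhedral_domain_def)

text \<open>Were a relative interior point of \<open>F\<close> inside the region, the points just across \<open>F\<close> would be covered
by some other element; this element contains the point, and by conformity it has \<open>F\<close> as a facet, so
\<open>F\<close> would be an interior face.\<close>

lemma exterior_face_boundary:
  assumes F: "F \<in> faces M" "F \<notin> interior_faces M"
  shows "F \<in> boundary_faces M"
proof -
  define K where "K = K_plus M F"
  have K: "K \<in> elems M" "F facet_of K" "outward_normal K F (nrm M F)"
    using K_plus[OF F(1)] by (auto simp: K_def)
  define \<nu> c where "\<nu> = nrm M F" and "c = \<nu> \<bullet> (SOME x. x \<in> F)"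
  note o = outward_normalD[OF K(3) facet_of_imp_nonempty[OF K(2)], folded \<nu>_def, folded c_def]
  have FK: "F face_of K" "F \<subseteq> K" using facet_of_imp_face_of[OF K(2)] facet_of_imp_subset[OF K(2)] by blast+
  have cF: "convex F" using FK(1) face_of_imp_convex by blast
  have ri: "p \<notin> region M" if p: "p \<in> rel_interior F" for p
  proof
    assume pr: "p \<in> region M"
    have pF: "p \<in> F" using p rel_interior_subset by blast
    \<comment> \<open>The union of the other elements is closed, so the limit of points just across
      \<open>F\<close> belongs to it.\<close>
    define U where "U = \<Union>(elems M - {K})"
    have "closed U" unfolding U_def
      using finite_elems elem_props(4) by (intro closed_Union) (auto intro: compact_imp_closed)
    have lim: "((\<lambda>t. p + t *\<^sub>R \<nu>) \<longlongrightarrow> p) (at_right (0::real))"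
      by (auto intro!: tendsto_eq_intros)
    have "eventually (\<lambda>t. p + t *\<^sub>R \<nu> \<in> region M) (at_right (0::real))"
      using lim open_region pr by (rule topological_tendstoD)
    moreover have "eventually (\<lambda>t::real. 0 < t) (at_right 0)"
      by (simp add: eventually_at_right_less)
    ultimately have "eventually (\<lambda>t. p + t *\<^sub>R \<nu> \<in> U) (at_right (0::real))"
    proof eventually_elim
      case (elim t)
      have "p + t *\<^sub>R \<nu> \<notin> K"
      proof
        assume "p + t *\<^sub>R \<nu> \<in> K"
        then have "\<nu> \<bullet> (p + t *\<^sub>R \<nu>) \<le> c" by (rule o(2))
        moreover have "\<nu> \<bullet> p = c" using pF o(3) by blast
        moreover have "\<nu> \<bullet> \<nu> = 1" using o(1) by (simp add: dot_square_norm)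
        ultimately show False using elim by (simp add: inner_add_right)
      qed
      moreover have "p + t *\<^sub>R \<nu> \<in> \<Union>(elems M)" using elim closure_subset Union_elems by blast
      ultimately show ?case unfolding U_def by blast
    qed
    then have "p \<in> U" using Lim_in_closed_set[OF \<open>closed U\<close> _ _ lim] by simp
    then obtain K' where K': "K' \<in> elems M" "K' \<noteq> K" "p \<in> K'" unfolding U_def by blast
    have fK: "K \<inter> K' face_of K" and fK': "K \<inter> K' face_of K'"
      using elems_face_to_face K K' by (blast, metis Int_commute)
    have sub: "F \<subseteq> K \<inter> K'"
      by (rule subset_of_face_of[OF fK FK(2)]) (use p pF FK K' in blast)
    have ne: "K \<inter> K' \<noteq> K" using elem_subset_eq[OF K(1) K'(1)] K'(2) by blast
    have "F face_of (K \<inter> K')" using face_of_subset[OF FK(1) sub] by simp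
    moreover have "aff_dim (K \<inter> K') < aff_dim K"
      using face_of_aff_dim_lt[OF elem_props(3)[OF K(1)] fK ne] .
    moreover have adF: "aff_dim F = aff_dim K - 1" using K(2) by (simp add: facet_of_def)
    ultimately have "F = K \<inter> K'"
      using face_of_aff_dim_lt[OF face_of_imp_convex[OF fK], of F] by fastforce
    then have "F facet_of K'"
      using fK' adF elem_props(2)[OF K(1)] elem_props(2)[OF K'(1)] pF by (auto simp: facet_of_def)
    then have "F \<in> interior_faces M" unfolding interior_faces_def using K K' by blast
    then show False using F by blast
  qed
  then have "region M \<inter> rel_interior F = {}" by blast
  then have "region M \<inter> closure (rel_interior F) = {}"
    using open_Int_closure_eq_empty[OF open_region] by blast
  moreover have "F \<subseteq> closure (rel_interior F)" using convex_closure_rel_interior[OF cF] closure_subset by blast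
  moreover have "F \<subseteq> closure (region M)" using FK(2) elem_subset_closure K(1) by blast
  ultimately have "F \<subseteq> frontier (region M)"
    unfolding frontier_def interior_open[OF open_region] by blast
  then show ?thesis using F(1) by (simp add: boundary_faces_def)
qed

lemma elem_interior_subset_region: "K \<in> elems M \<Longrightarrow> interior K \<subseteq> region M"
  using interior_mono[OF elem_subset_closure] interior_closure_region by blast

lemma negligible_skeleton: "negligible (region M - (\<Union>K\<in>elems M. interior K))"
proof -
  have "region M \<subseteq> \<Union>(elems M)" using Union_elems closure_subset by blast
  then have "region M - (\<Union>K\<in>elems M. interior K) \<subseteq> (\<Union>K\<in>elems M. frontier K)"
  proof (intro subsetI)
    fix x assume x: "x \<in> region M - (\<Union>K\<in>elems M. interior K)"
    then obtain K where K: "K \<in> elems M" "x \<in> K" using \<open>region M \<subseteq> \<Union>(elems M)\<close> by blast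
    then have "x \<in> frontier K" using x closure_subset[of K] by (auto simp: frontier_def)
    then show "x \<in> (\<Union>K\<in>elems M. frontier K)" using K(1) by blast
  qed
  moreover have "negligible (\<Union>K\<in>elems M. frontier K)"
    using finite_elems elem_props(3) by (intro negligible_Union) (auto intro: negligible_convex_frontier)
  ultimately show ?thesis using negligible_subset by blast
qed

end

section \<open>Traces of piecewise polynomials\<close>

text \<open>On the line through \<open>x\<close> and a point of the open set, \<open>p\<close> is a polynomial in one variable with
infinitely many zeros.\<close>

lemma real_polynomial_zero_on_open:
  fixes p :: "'a::real_normed_vector \<Rightarrow> real"
  assumes p: "real_polynomial_function p" and U: "open U" "x0 \<in> U" "\<And>x. x \<in> U \<Longrightarrow> p x = 0"
  shows "p x = 0"
proof -
  define q where "q = p \<circ> (\<lambda>t. x0 + t *\<^sub>R (x - x0))"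
  have "polynomial_function (\<lambda>t::real. x0 + t *\<^sub>R (x - x0))"
    by (intro polynomial_function_add polynomial_function_mult polynomial_function_const polynomial_function_id)
  then have "real_polynomial_function q" unfolding q_def using p by (rule real_polynomial_function_compose)
  then obtain a n where q: "q = (\<lambda>t. \<Sum>i\<le>n. a i * t ^ i)" by (auto simp: real_polynomial_function_iff_sum)
  have "((\<lambda>t. x0 + t *\<^sub>R (x - x0)) \<longlongrightarrow> x0) (at_right (0::real))"
    by (auto intro!: tendsto_eq_intros)
  then have "eventually (\<lambda>t. x0 + t *\<^sub>R (x - x0) \<in> U) (at_right (0::real))"
    using U(1,2) by (rule topological_tendstoD)
  then obtain b where b: "b > 0" "\<And>t. 0 < t \<Longrightarrow> t < b \<Longrightarrow> x0 + t *\<^sub>R (x - x0) \<in> U"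
    by (auto simp: eventually_at_right_field)
  then have "{0<..<b} \<subseteq> {t. (\<Sum>i\<le>n. a i * t ^ i) = 0}"
  proof (intro subsetI CollectI)
    fix t assume "t \<in> {0<..<b}"
    then have "q t = 0" using b(2) U(3) by (simp add: q_def)
    then show "(\<Sum>i\<le>n. a i * t ^ i) = 0" by (simp add: q)
  qed
  then have "infinite {t. (\<Sum>i\<le>n. a i * t ^ i) = 0}"
    using b(1) infinite_Ioo finite_subset by blast
  then have "\<forall>i\<le>n. a i = 0" using polyfun_roots_finite by blast
  then have "q 1 = 0" by (simp add: q)
  then show ?thesis by (simp add: q_def)
qed

text \<open>This makes \<^const>\<open>restr\<close> well defined: the traces do not depend on the representative of an
\<open>L\<^sup>2\<close> class.\<close>

lemma polynomial_eq_if_AE_eq: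
  fixes p q :: "real^'n \<Rightarrow> 'b::euclidean_space"
  assumes p: "polynomial_function p" and q: "polynomial_function q"
    and K: "interior K \<noteq> {}" and ae: "AE x in lebesgue. x \<in> K \<longrightarrow> p x = q x"
  shows "p = q"
proof -
  have d: "polynomial_function (\<lambda>x. p x - q x)" using p q by blast
  then have cont: "continuous_on UNIV (\<lambda>x. p x - q x)"
    using continuous_on_polymonial_function by blast
  \<comment> \<open>By continuity this exceptional set is open; an open null set is empty.\<close>
  define N where "N = interior K \<inter> (\<lambda>x. p x - q x) -` (- {0})"
  have "open N" unfolding N_def
    using open_vimage[OF _ cont, of "- {0}"] by (intro open_Int) auto
  have "AE x in lebesgue. x \<notin> N"
    using ae by eventually_elim (use interior_subset[of K] in \<open>auto simp: N_def\<close>)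
  moreover have "N \<in> sets lebesgue" using \<open>open N\<close> by (simp add: borel_open sets_completionI_sets)
  ultimately have "N \<in> null_sets lebesgue" by (simp add: AE_iff_null_sets)
  then have "negligible N" by (simp add: negligible_iff_null_sets)
  then have N: "N = {}" using \<open>open N\<close> open_not_negligible by blast
  obtain x0 where x0: "x0 \<in> interior K" using K by blast
  have "(p x - q x) \<bullet> b = 0" if "b \<in> Basis" for x b
  proof (rule real_polynomial_zero_on_open[OF _ open_interior x0])
    show "real_polynomial_function (\<lambda>x. (p x - q x) \<bullet> b)"
      using d that by (simp add: polynomial_function_iff_Basis_inner)
    show "(p x - q x) \<bullet> b = 0" if "x \<in> interior K" for x
    proof -
      have "x \<notin> N" using N by simp
      then have "p x - q x = 0" using that unfolding N_def by blast
      then show ?thesis by simp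
    qed
  qed
  then have "p x - q x = 0" for x by (metis euclidean_all_zero_iff)
  then show ?thesis by (auto simp: fun_eq_iff)
qed

lemma restr_eq:
  fixes p :: "real^'n \<Rightarrow> 'b::euclidean_space"
  assumes p: "polynomial_function p" and K: "interior K \<noteq> {}" and ae: "agrees_on K f p"
  shows "restr f K = p"
  unfolding restr_def
proof (rule the_equality)
  fix q assume q: "polynomial_function q \<and> agrees_on K f q"
  then have "AE x in lebesgue. x \<in> K \<longrightarrow> f x = q x" by (simp add: agrees_on_def)
  moreover have "AE x in lebesgue. x \<in> K \<longrightarrow> f x = p x" using ae by (simp add: agrees_on_def)
  ultimately have "AE x in lebesgue. x \<in> K \<longrightarrow> q x = p x" by eventually_elim auto
  then show "q = p" using polynomial_eq_if_AE_eq[of q p K] p q K by blast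
qed (use p ae in simp)

lemma polynomial_function_dot:
  fixes p q :: "'a::real_normed_vector \<Rightarrow> 'b::euclidean_space"
  assumes "polynomial_function p" "polynomial_function q"
  shows "real_polynomial_function (\<lambda>x. p x \<bullet> q x)"
proof -
  have "real_polynomial_function (\<lambda>x. \<Sum>b\<in>Basis. (p x \<bullet> b) * (q x \<bullet> b))"
    using assms by (intro real_polynomial_function_sum real_polynomial_function.intros(4))
      (auto simp: polynomial_function_iff_Basis_inner)
  then show ?thesis by (simp add: euclidean_inner[symmetric])
qed

lemma real_polynomial_has_derivative:
  fixes f :: "'a::real_normed_vector \<Rightarrow> real"
  assumes "real_polynomial_function f"
  shows "\<exists>f'. (\<forall>x. (f has_derivative f' x) (at x)) \<and> (\<forall>e. real_polynomial_function (\<lambda>x. f' x e))"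
  using assms
proof induction
  case (linear f)
  then show ?case
    by (intro exI[of _ "\<lambda>x. f"] conjI allI bounded_linear_imp_has_derivative real_polynomial_function.intros(2))
next
  case (const c)
  show ?case by (intro exI[of _ "\<lambda>x e. 0"]) auto
next
  case (add f g)
  then obtain f' g' where 
    "\<And>x. (f has_derivative f' x) (at x)" "\<And>e. real_polynomial_function (\<lambda>x. f' x e)"
    "\<And>x. (g has_derivative g' x) (at x)" "\<And>e. real_polynomial_function (\<lambda>x. g' x e)"
    by blast
  then show ?case
    by (intro exI[of _ "\<lambda>x e. f' x e + g' x e"]) (auto intro!: has_derivative_add real_polynomial_function.intros(3))
next
  case (mult f g)
  then obtain f' g' where 
    "\<And>x. (f has_derivative f' x) (at x)" "\<And>e. real_polynomial_function (\<lambda>x. f' x e)"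
    "\<And>x. (g has_derivative g' x) (at x)" "\<And>e. real_polynomial_function (\<lambda>x. g' x e)"
    by blast
  with mult show ?case
    by (intro exI[of _ "\<lambda>x e. f x * g' x e + f' x e * g x"]) (auto intro!: has_derivative_mult real_polynomial_function.intros(3,4))
qed

lemma polynomial_function_component:
  fixes p :: "real^'n \<Rightarrow> real^'m"
  shows "polynomial_function p \<longleftrightarrow> (\<forall>i. real_polynomial_function (\<lambda>x. p x $ i))"
  by (auto simp: polynomial_function_iff_Basis_inner Basis_vec_def cart_eq_inner_axis)

lemma polynomial_has_derivative:
  fixes p :: "real^'n \<Rightarrow> real^'m"
  assumes "polynomial_function p"
  shows "(p has_derivative (frechet_derivative p (at x))) (at x)"
  using differentiable_at_polynomial_function[OF assms] frechet_derivative_works by blast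

lemma polynomial_pderivative:
  fixes p :: "real^'n \<Rightarrow> real^'m"
  assumes p: "polynomial_function p"
  shows "polynomial_function (\<lambda>x. frechet_derivative p (at x) e)"
  unfolding polynomial_function_component
proof
  fix i
  obtain f' where f': "\<And>x. ((\<lambda>x. p x $ i) has_derivative f' x) (at x)"
     "\<And>e. real_polynomial_function (\<lambda>x. f' x e)"
    using real_polynomial_has_derivative[of "\<lambda>x. p x $ i"] p polynomial_function_component by blast
  have "((\<lambda>x. p x $ i) has_derivative (\<lambda>h. frechet_derivative p (at x) h $ i)) (at x)" for x
    using bounded_linear.has_derivative[OF bounded_linear_vec_nth polynomial_has_derivative[OF p]] .
  then have "f' x = (\<lambda>h. frechet_derivative p (at x) h $ i)" for x
    using f'(1) has_derivative_unique by blast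
  then show "real_polynomial_function (\<lambda>x. frechet_derivative p (at x) e $ i)"
    using f'(2)[of e] by simp
qed

lemma Poly_polynomial:
  assumes "p \<in> Poly j" shows "real_polynomial_function p"
proof -
  obtain c :: "('a \<Rightarrow> nat) \<Rightarrow> real" where
    c: "p = (\<lambda>x. \<Sum>\<alpha> | (\<Sum>i\<in>UNIV. \<alpha> i) \<le> j. c \<alpha> * (\<Prod>i\<in>UNIV. (x $ i) ^ \<alpha> i))"
    using assms by (auto simp: Poly_def fun_eq_iff)
  have "real_polynomial_function (\<lambda>x::real^'a. \<Sum>\<alpha>\<in>S. c \<alpha> * (\<Prod>i\<in>UNIV. (x $ i) ^ \<alpha> i))" for S
  proof (cases "finite S")
    case True
    then show ?thesis
      by (intro real_polynomial_function_sum real_polynomial_function.intros(4) real_polynomial_function.intros(2)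
          real_polynomial_function_prod real_polynomial_function_power real_polynomial_function.intros(1)
          bounded_linear_vec_nth) auto
  qed auto
  then show ?thesis unfolding c .
qed

lemma vPoly_polynomial: "p \<in> vPoly j \<Longrightarrow> polynomial_function p"
  unfolding polynomial_function_component vPoly_def using Poly_polynomial by blast

lemma local_space_polynomial: "p \<in> local_space fam k \<Longrightarrow> polynomial_function p"
  by (cases fam) (auto intro!: polynomial_function_add polynomial_function_mult dest!: vPoly_polynomial
      simp: real_polynomial_function_eq[symmetric] Poly_polynomial)

text \<open>The common ground of the discontinuous and the \<open>H(div)\<close> velocity spaces: \<^const>\<open>restr\<close>, and with it
traces, jumps and averages, are meaningful for these functions.\<close>

definition piecewise_polynomial :: "('n::finite) mesh \<Rightarrow> (real^'n \<Rightarrow> 'b::euclidean_space) \<Rightarrow> bool" where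
  "piecewise_polynomial M v \<longleftrightarrow> (\<forall>K\<in>elems M. \<exists>p. polynomial_function p \<and> agrees_on K v p)"

lemma V_h_piecewise_polynomial: "v \<in> V_h M k \<Longrightarrow> piecewise_polynomial M v"
  unfolding V_h_def piecewise_polynomial_def using vPoly_polynomial by blast

lemma V_div_piecewise_polynomial: "v \<in> V_div M fam k \<Longrightarrow> piecewise_polynomial M v"
  unfolding V_div_def piecewise_polynomial_def using local_space_polynomial by blast

context
  fixes M :: "('n::finite) mesh"
  assumes mesh: "simplicial_mesh M"
begin

lemma restr_polynomial:
  assumes "piecewise_polynomial M v" "K \<in> elems M"
  shows "polynomial_function (restr v K)" "AE x in lebesgue. x \<in> K \<longrightarrow> v x = restr v K x"
proof -
  obtain p where p: "polynomial_function p" "agrees_on K v p"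
    using assms unfolding piecewise_polynomial_def by blast
  then have "restr v K = p" using restr_eq elem_props(1)[OF mesh assms(2)] by blast
  with p show "polynomial_function (restr v K)" "AE x in lebesgue. x \<in> K \<longrightarrow> v x = restr v K x"
    by (auto simp: agrees_on_def)
qed

lemma restr_dot:
  assumes "piecewise_polynomial M v" "K \<in> elems M"
  shows "restr (\<lambda>x. v x \<bullet> v x) K = (\<lambda>x. restr v K x \<bullet> restr v K x)"
proof (rule restr_eq)
  note r = restr_polynomial[OF assms]
  show "polynomial_function (\<lambda>x. restr v K x \<bullet> restr v K x)"
    using polynomial_function_dot[OF r(1) r(1)] by (simp add: real_polynomial_function_eq)
  show "interior K \<noteq> {}" using elem_props(1)[OF mesh assms(2)] .
  show "agrees_on K (\<lambda>x. v x \<bullet> v x) (\<lambda>x. restr v K x \<bullet> restr v K x)"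
    unfolding agrees_on_def using r(2) by eventually_elim auto
qed

text \<open>The skeleton is a null set, so an integral over the domain is a sum over the elements, on each of
which the integrand may be replaced by its polynomial representative. Measurability of \<open>\<phi>\<close> comes
for free from completeness of Lebesgue measure.\<close>

lemma integral_region:
  fixes \<phi> :: "real^'n \<Rightarrow> real"
  assumes ae: "\<And>K. K \<in> elems M \<Longrightarrow> AE x in lebesgue. x \<in> interior K \<longrightarrow> \<phi> x = q K x"
    and q: "\<And>K. K \<in> elems M \<Longrightarrow> continuous_on UNIV (q K)"
  shows "(\<integral>x. \<phi> x \<partial>lebesgue_on (region M)) = (\<Sum>K\<in>elems M. \<integral>x. indicator K x * q K x \<partial>lborel)"
proof -
  have fin: "finite (elems M)" using finite_elems[OF mesh] .
  define g where "g x = (\<Sum>K\<in>elems M. indicator K x * q K x)" for x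
  have int: "integrable lborel (\<lambda>x. indicator K x * q K x)" if "K \<in> elems M" for K
    by (rule integrable_indicator_continuous[OF elem_props(4)[OF mesh that] q[OF that]])
  have gm: "g \<in> borel_measurable lborel" unfolding g_def
    using int by (intro borel_measurable_sum borel_measurable_integrable)
  then have gm': "g \<in> borel_measurable lebesgue" by (rule measurable_completion)
  have neg: "AE x in lebesgue. x \<notin> S" if "negligible S" for S :: "(real^'n) set"
    using that AE_not_in negligible_iff_null_sets by blast
  have 1: "AE x in lebesgue. \<forall>K\<in>elems M. x \<in> interior K \<longrightarrow> \<phi> x = q K x"
    using ae fin by (intro AE_finite_allI) auto
  have 2: "AE x in lebesgue. \<forall>K\<in>elems M. x \<notin> frontier K"
    using fin by (intro AE_finite_allI neg negligible_convex_frontier elem_props(3)[OF mesh])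
  have eq: "AE x in lebesgue. g x = indicator (region M) x * \<phi> x"
    using 1 2 neg[OF negligible_skeleton[OF mesh]]
  proof eventually_elim
    case (elim x)
    have int: "x \<in> interior K" if "K \<in> elems M" "x \<in> K" for K
      using elim(2) that closure_subset[of K] by (auto simp: frontier_def)
    show ?case
    proof (cases "x \<in> region M")
      case True
      then obtain K where K: "K \<in> elems M" "x \<in> interior K" using elim(3) by blast
      have "g x = (\<Sum>L\<in>elems M. if L = K then q K x else 0)"
        unfolding g_def
      proof (intro sum.cong refl)
        fix L assume L: "L \<in> elems M"
        show "indicator L x * q L x = (if L = K then q K x else 0)"
        proof (cases "L = K")
          case False
          then have "x \<notin> L" using elem_interior_disjoint[OF mesh K(1) L] K(2) by blast
          then show ?thesis using False by simp
        next
          case True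
          then have "x \<in> L" using K(2) interior_subset by blast
          then show ?thesis using True by simp
        qed
      qed
      also have "\<dots> = q K x" using fin K by simp
      also have "\<dots> = \<phi> x" using elim(1) K by simp
      finally show ?thesis using True by simp
    next
      case False
      then have "x \<notin> K" if "K \<in> elems M" for K
        using int[OF that] elem_interior_subset_region[OF mesh that] by blast
      then show ?thesis using False by (simp add: g_def)
    qed
  qed
  have m: "(\<lambda>x. indicator (region M) x * \<phi> x) \<in> borel_measurable lebesgue"
    by (rule borel_measurable_AE[OF gm' eq])
  have "region M \<in> sets lebesgue" using open_region[OF mesh] by (simp add: borel_open sets_completionI_sets)
  then have "(\<integral>x. \<phi> x \<partial>lebesgue_on (region M)) = (\<integral>x. indicator (region M) x * \<phi> x \<partial>lebesgue)"
    by (subst integral_restrict_space) auto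
  also have "\<dots> = (\<integral>x. g x \<partial>lebesgue)"
    by (rule integral_cong_AE[OF m gm']) (use eq in eventually_elim, simp)
  also have "\<dots> = (\<integral>x. g x \<partial>lborel)" by (rule integral_completion[OF gm])
  also have "\<dots> = (\<Sum>K\<in>elems M. \<integral>x. indicator K x * q K x \<partial>lborel)"
    unfolding g_def using int by (rule Bochner_Integration.integral_sum)
  finally show ?thesis .
qed

end

section \<open>The energy identity of the convective forms\<close>

lemma continuous_on_polynomial:
  fixes p :: "'a::real_normed_vector \<Rightarrow> 'b::euclidean_space"
  shows "polynomial_function p \<Longrightarrow> continuous_on UNIV p"
  by (rule continuous_on_polymonial_function)

text \<open>The divergence theorem for the field \<open>\<bar>p\<bar>\<^sup>2 p\<close>, whose divergence is
\<open>2 (p \<bullet> \<nabla> p) \<bullet> p + (\<nabla> \<bullet> p) \<bar>p\<bar>\<^sup>2\<close>. Half of the term with the divergence is exactly what is needed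
to make the volume contribution a boundary term.\<close>

lemma simplex_energy:
  fixes K :: "(real^'n) set" and \<nu> :: "(real^'n) set \<Rightarrow> real^'n" and p :: "real^'n \<Rightarrow> real^'n"
  assumes K: "int CARD('n) simplex K"
    and \<nu>: "\<And>F. F facet_of K \<Longrightarrow> outward_normal K F (\<nu> F)"
    and p: "polynomial_function p"
  shows "(\<integral>x. indicator K x * ((\<Sum>j\<in>UNIV. (p x $ j) *\<^sub>R pderivative j p x) \<bullet> p x) \<partial>lborel)
     + 1/2 * (\<integral>x. indicator K x * ((\<Sum>j\<in>UNIV. pderivative j p x $ j) * (p x \<bullet> p x)) \<partial>lborel)
     = 1/2 * (\<Sum>F | F facet_of K.
        LINT y:F|hyperplane_measure (\<nu> F) (\<nu> F \<bullet> (SOME x. x \<in> F)). (p y \<bullet> \<nu> F) * (p y \<bullet> p y))"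
proof -
  define D where "D x e = frechet_derivative p (at x) e" for x e
  have D: "(p has_derivative D x) (at x)" for x
    using polynomial_has_derivative[OF p] by (simp add: D_def[abs_def])
  have Dp: "polynomial_function (\<lambda>x. D x e)" for e
    using polynomial_pderivative[OF p] by (simp add: D_def)
  have pd: "pderivative j p x = D x (axis j 1)" for j x by (simp add: pderivative_def D_def)
  have KC: "compact K" using K compact_simplex by blast
  note cont [continuous_intros] = continuous_on_polynomial[OF p] continuous_on_polynomial[OF Dp]
  define f where "f j x = p x $ j * (p x \<bullet> p x)" for j x
  define f' where "f' j x h = p x $ j * (p x \<bullet> D x h + D x h \<bullet> p x) + D x h $ j * (p x \<bullet> p x)" for j x h
  have f: "(f j has_derivative f' j x) (at x)" for j x
    unfolding f_def[abs_def] f'_def[abs_def]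
    by (intro has_derivative_mult has_derivative_inner D
        bounded_linear.has_derivative[OF bounded_linear_vec_nth])
  have f': "continuous_on UNIV (\<lambda>x. f' j x e)" for j e
    unfolding f'_def by (intro continuous_intros)
  have fc: "continuous_on UNIV (f j)" for j
    unfolding f_def[abs_def] by (intro continuous_intros)
  define A where "A x = (\<Sum>j\<in>UNIV. (p x $ j) *\<^sub>R D x (axis j 1)) \<bullet> p x" for x
  define B where "B x = (\<Sum>j\<in>UNIV. D x (axis j 1) $ j) * (p x \<bullet> p x)" for x
  have Ac: "continuous_on UNIV A" and Bc: "continuous_on UNIV B"
    unfolding A_def[abs_def] B_def[abs_def] by (intro continuous_intros)+
  have AB: "(\<Sum>j\<in>UNIV. f' j x (axis j 1)) = 2 * A x + B x" for x
    by (simp add: A_def B_def f'_def sum.distrib inner_sum_left sum_distrib_right sum_distrib_left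
        inner_sum_right inner_commute algebra_simps)
  note int = integrable_indicator_continuous[OF KC]
  have "2 * (\<integral>x. indicator K x * A x \<partial>lborel) + (\<integral>x. indicator K x * B x \<partial>lborel)
      = (\<integral>x. 2 * (indicator K x * A x) + indicator K x * B x \<partial>lborel)"
    using int[OF Ac] int[OF Bc] by simp
  also have "\<dots> = (\<integral>x. (\<Sum>j\<in>UNIV. indicator K x * f' j x (axis j 1)) \<partial>lborel)"
    by (simp add: sum_distrib_left[symmetric] AB algebra_simps)
  also have "\<dots> = (\<Sum>j\<in>UNIV. \<integral>x. indicator K x * f' j x (axis j 1) \<partial>lborel)"
    using int[OF f'] by (rule Bochner_Integration.integral_sum)
  also have "\<dots> = (\<Sum>j\<in>UNIV. \<Sum>F | F facet_of K. (\<nu> F \<bullet> axis j 1) *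
      (LINT y:F|hyperplane_measure (\<nu> F) (\<nu> F \<bullet> (SOME x. x \<in> F)). f j y))"
    using simplex_divergence[OF K \<nu> f f'] by simp
  also have "\<dots> = (\<Sum>F | F facet_of K. \<Sum>j\<in>UNIV. (\<nu> F \<bullet> axis j 1) *
      (LINT y:F|hyperplane_measure (\<nu> F) (\<nu> F \<bullet> (SOME x. x \<in> F)). f j y))"
    by (rule sum.swap)
  also have "\<dots> = (\<Sum>F | F facet_of K.
        LINT y:F|hyperplane_measure (\<nu> F) (\<nu> F \<bullet> (SOME x. x \<in> F)). (p y \<bullet> \<nu> F) * (p y \<bullet> p y))"
  proof (intro sum.cong refl)
    fix F assume "F \<in> {F. F facet_of K}"
    then have F: "F facet_of K" by simp
    have FC: "compact F"
      using F facet_of_imp_face_of face_of_imp_compact KC K convex_simplex by blast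
    have n: "norm (\<nu> F) = 1" using \<nu>[OF F] by (simp add: outward_normal_def)
    let ?m = "hyperplane_measure (\<nu> F) (\<nu> F \<bullet> (SOME x. x \<in> F))"
    have "(LINT y:F|?m. (p y \<bullet> \<nu> F) * (p y \<bullet> p y))
        = (\<integral>y. (\<Sum>j\<in>UNIV. (\<nu> F \<bullet> axis j 1) * (indicator F y *\<^sub>R f j y)) \<partial>?m)"
      unfolding set_lebesgue_integral_def
      by (intro Bochner_Integration.integral_cong refl)
         (simp add: f_def inner_vec_def[of "p _" "\<nu> F"] inner_axis sum_distrib_right sum_distrib_left mult_ac)
    also have "\<dots> = (\<Sum>j\<in>UNIV. \<integral>y. (\<nu> F \<bullet> axis j 1) * (indicator F y *\<^sub>R f j y) \<partial>?m)"
      using set_integrable_hyperplane_measure[OF FC fc n] unfolding set_integrable_def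
      by (intro Bochner_Integration.integral_sum integrable_mult_right) blast
    also have "\<dots> = (\<Sum>j\<in>UNIV. (\<nu> F \<bullet> axis j 1) * (LINT y:F|?m. f j y))"
      by (simp add: set_lebesgue_integral_def)
    finally show "(\<Sum>j\<in>UNIV. (\<nu> F \<bullet> axis j 1) * (LINT y:F|?m. f j y))
        = (LINT y:F|?m. (p y \<bullet> \<nu> F) * (p y \<bullet> p y))" by simp
  qed
  finally show ?thesis unfolding pd A_def B_def by simp
qed

lemma face_integral_opposite_normal:
  fixes g :: "real^'n \<Rightarrow> real"
  assumes "compact F" "continuous_on UNIV g" "norm \<nu> = 1"
  shows "(LINT y:F|hyperplane_measure (- \<nu>) (- c). g y) = (LINT y:F|hyperplane_measure \<nu> c. g y)"
  using integral_hyperplane_measure_uminus[OF indicator_mult_borel[OF assms(1,2)] assms(3)]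
  by (simp add: set_lebesgue_integral_def)

context
  fixes M :: "('n::finite) mesh"
  assumes mesh: "simplicial_mesh M"
begin

lemma compact_face: "F \<in> faces M \<Longrightarrow> compact F"
  unfolding faces_def using facet_of_imp_face_of face_of_imp_compact elem_props(3,4)[OF mesh] by blast

lemma set_integrable_face:
  "F \<in> faces M \<Longrightarrow> continuous_on UNIV g \<Longrightarrow> set_integrable (face_measure M F) F (g :: real^'n \<Rightarrow> real)"
  unfolding face_measure_def using compact_face nrm_unit[OF mesh] by (intro set_integrable_hyperplane_measure) auto

lemma sum_faces_split:
  fixes h :: "(real^'n) set \<Rightarrow> real"
  shows "(\<Sum>F\<in>faces M. h F) = (\<Sum>F\<in>interior_faces M. h F) + (\<Sum>F\<in>faces M - interior_faces M. h F)"
  using sum.subset_diff[OF interior_faces_subset finite_faces[OF mesh], of h] by (simp add: add.commute)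

context
  fixes u :: "real^'n \<Rightarrow> real^'n"
  assumes u: "piecewise_polynomial M u"
begin

text \<open>Exchanging the sums over elements and facets collects the contributions to each face: two with
opposite normals on an interior face, one on a boundary face.\<close>

lemma sum_element_energy:
  "(\<Sum>K\<in>elems M. (\<integral>x. indicator K x * ((\<Sum>j\<in>UNIV. (restr u K x $ j) *\<^sub>R pderivative j (restr u K) x) \<bullet> restr u K x) \<partial>lborel)
     + 1/2 * (\<integral>x. indicator K x * ((\<Sum>j\<in>UNIV. pderivative j (restr u K) x $ j) * (restr u K x \<bullet> restr u K x)) \<partial>lborel))
   = 1/2 * (\<Sum>F\<in>interior_faces M. LINT y:F|face_measure M F.
        (restr u (K_plus M F) y \<bullet> nrm M F) * (restr u (K_plus M F) y \<bullet> restr u (K_plus M F) y)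
      - (restr u (K_minus M F) y \<bullet> nrm M F) * (restr u (K_minus M F) y \<bullet> restr u (K_minus M F) y))
   + 1/2 * (\<Sum>F\<in>faces M - interior_faces M. LINT y:F|face_measure M F.
        (restr u (K_plus M F) y \<bullet> nrm M F) * (restr u (K_plus M F) y \<bullet> restr u (K_plus M F) y))"
  (is "?L = _")
proof -
  define g where "g K F y = (restr u K y \<bullet> nrm M F) * (restr u K y \<bullet> restr u K y)" for K F y
  \<comment> \<open>The exterior normal of \<open>K\<close> on \<open>F\<close> is \<open>s K F\<close> times
    the fixed normal of \<open>F\<close>.\<close>
  define s where "s K F = (if K = K_plus M F then 1 else - 1 :: real)" for K F
  define I where "I K F = s K F * (LINT y:F|face_measure M F. g K F y)" for K F
  have gc: "continuous_on UNIV (g K F)" if "K \<in> elems M" for K F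
    unfolding g_def[abs_def] using restr_polynomial(1)[OF mesh u that]
    by (intro continuous_intros continuous_on_polynomial)
  have "?L = (\<Sum>K\<in>elems M. 1/2 * (\<Sum>F | F \<in> faces M \<and> F facet_of K. I K F))"
  proof (intro sum.cong refl)
    fix K assume K: "K \<in> elems M"
    define \<nu> where "\<nu> F = s K F *\<^sub>R nrm M F" for F
    have \<nu>: "outward_normal K F (\<nu> F)" if "F facet_of K" for F
    proof -
      have "F \<in> faces M" using that K by (auto simp: faces_def)
      then show ?thesis
        unfolding \<nu>_def s_def using K_plus(3)[OF mesh] outward_normal_other[OF mesh K that] by auto
    qed
    have "(LINT y:F|hyperplane_measure (\<nu> F) (\<nu> F \<bullet> (SOME x. x \<in> F)). (restr u K y \<bullet> \<nu> F) * (restr u K y \<bullet> restr u K y))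
        = I K F" if F: "F facet_of K" for F
    proof -
      have Ff: "F \<in> faces M" using F K by (auto simp: faces_def)
      have "(LINT y:F|hyperplane_measure (\<nu> F) (\<nu> F \<bullet> (SOME x. x \<in> F)). (restr u K y \<bullet> \<nu> F) * (restr u K y \<bullet> restr u K y))
          = (LINT y:F|hyperplane_measure (\<nu> F) (\<nu> F \<bullet> (SOME x. x \<in> F)). s K F * g K F y)"
        by (simp add: \<nu>_def g_def mult.assoc)
      also have "\<dots> = s K F * (LINT y:F|hyperplane_measure (\<nu> F) (\<nu> F \<bullet> (SOME x. x \<in> F)). g K F y)"
        by simp
      also have "(LINT y:F|hyperplane_measure (\<nu> F) (\<nu> F \<bullet> (SOME x. x \<in> F)). g K F y)
          = (LINT y:F|face_measure M F. g K F y)"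
        using face_integral_opposite_normal[OF compact_face[OF Ff] gc[OF K] nrm_unit[OF mesh Ff]]
        by (simp add: \<nu>_def s_def face_measure_def)
      finally show ?thesis by (simp add: I_def)
    qed
    moreover have "{F. F facet_of K} = {F. F \<in> faces M \<and> F facet_of K}"
      using K by (auto simp: faces_def)
    ultimately show "(\<integral>x. indicator K x * ((\<Sum>j\<in>UNIV. (restr u K x $ j) *\<^sub>R pderivative j (restr u K) x) \<bullet> restr u K x) \<partial>lborel)
     + 1/2 * (\<integral>x. indicator K x * ((\<Sum>j\<in>UNIV. pderivative j (restr u K) x $ j) * (restr u K x \<bullet> restr u K x)) \<partial>lborel)
     = 1/2 * (\<Sum>F | F \<in> faces M \<and> F facet_of K. I K F)"
      using simplex_energy[OF elem_simplex[OF mesh K] \<nu> restr_polynomial(1)[OF mesh u K]] by simp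
  qed
  also have "\<dots> = 1/2 * (\<Sum>F\<in>faces M. \<Sum>K | K \<in> elems M \<and> F facet_of K. I K F)"
    using sum.swap_restrict[OF finite_elems[OF mesh] finite_faces[OF mesh], of I "\<lambda>K F. F facet_of K"]
    by (simp only: sum_distrib_left[symmetric])
  also have "(\<Sum>F\<in>faces M. \<Sum>K | K \<in> elems M \<and> F facet_of K. I K F)
      = (\<Sum>F\<in>interior_faces M. \<Sum>K | K \<in> elems M \<and> F facet_of K. I K F)
      + (\<Sum>F\<in>faces M - interior_faces M. \<Sum>K | K \<in> elems M \<and> F facet_of K. I K F)"
    by (rule sum_faces_split)
  also have "(\<Sum>F\<in>interior_faces M. \<Sum>K | K \<in> elems M \<and> F facet_of K. I K F)
      = (\<Sum>F\<in>interior_faces M. LINT y:F|face_measure M F. g (K_plus M F) F y - g (K_minus M F) F y)"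
  proof (intro sum.cong refl)
    fix F assume F: "F \<in> interior_faces M"
    then have Ff: "F \<in> faces M" using interior_faces_subset by blast
    note km = K_minus[OF mesh F] and kp = K_plus[OF mesh Ff]
    have "(\<Sum>K | K \<in> elems M \<and> F facet_of K. I K F) = I (K_plus M F) F + I (K_minus M F) F"
      using km(3) by (simp add: km(4))
    also have "\<dots> = (LINT y:F|face_measure M F. g (K_plus M F) F y) - (LINT y:F|face_measure M F. g (K_minus M F) F y)"
      using km(3) by (simp add: I_def s_def)
    also have "\<dots> = (LINT y:F|face_measure M F. g (K_plus M F) F y - g (K_minus M F) F y)"
      by (rule set_integral_diff(2)[symmetric]) (intro set_integrable_face Ff gc km kp)+
    finally show "(\<Sum>K | K \<in> elems M \<and> F facet_of K. I K F) = \<dots>" .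
  qed
  also have "(\<Sum>F\<in>faces M - interior_faces M. \<Sum>K | K \<in> elems M \<and> F facet_of K. I K F)
      = (\<Sum>F\<in>faces M - interior_faces M. LINT y:F|face_measure M F. g (K_plus M F) F y)"
  proof (intro sum.cong refl)
    fix F assume F: "F \<in> faces M - interior_faces M"
    then have eq: "{K \<in> elems M. F facet_of K} = {K_plus M F}"
      by (intro exterior_face_elems[OF mesh]) auto
    show "(\<Sum>K | K \<in> elems M \<and> F facet_of K. I K F) = (LINT y:F|face_measure M F. g (K_plus M F) F y)"
      unfolding eq by (simp add: I_def s_def)
  qed
  finally show ?thesis unfolding g_def by (simp add: distrib_left)
qed

lemma elem_operators:
  assumes K: "K \<in> elems M" "x \<in> interior K"
  shows "div_h M v x = (\<Sum>j\<in>UNIV. pderivative j (restr v K) x $ j)"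
    and "adv_h M \<beta> v x = (\<Sum>j\<in>UNIV. (\<beta> x $ j) *\<^sub>R pderivative j (restr v K) x)"
proof -
  have ind: "indicator (interior L) x = (if L = K then 1 else 0 :: real)" if L: "L \<in> elems M" for L
  proof (cases "L = K")
    case False
    then have "x \<notin> interior L" using elem_interior_disjoint[OF mesh K(1) L] K(2) interior_subset[of L] by blast
    then show ?thesis using False by simp
  qed (use K in simp)
  show "div_h M v x = (\<Sum>j\<in>UNIV. pderivative j (restr v K) x $ j)"
    unfolding div_h_def using K(1) finite_elems[OF mesh]
    by (simp add: ind if_distrib if_distribR cong: if_cong)
  show "adv_h M \<beta> v x = (\<Sum>j\<in>UNIV. (\<beta> x $ j) *\<^sub>R pderivative j (restr v K) x)"
    unfolding adv_h_def using K(1) finite_elems[OF mesh]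
    by (simp add: ind if_distrib if_distribR cong: if_cong)
qed

lemma volume_terms:
  "ip (region M) (adv_h M u u) u + 1/2 * ip (region M) (\<lambda>x. div_h M u x *\<^sub>R u x) u =
   (\<Sum>K\<in>elems M. (\<integral>x. indicator K x * ((\<Sum>j\<in>UNIV. (restr u K x $ j) *\<^sub>R pderivative j (restr u K) x) \<bullet> restr u K x) \<partial>lborel)
     + 1/2 * (\<integral>x. indicator K x * ((\<Sum>j\<in>UNIV. pderivative j (restr u K) x $ j) * (restr u K x \<bullet> restr u K x)) \<partial>lborel))"
proof -
  have pol: "polynomial_function (restr u K)" "polynomial_function (pderivative j (restr u K))" if "K \<in> elems M" for K j
    using restr_polynomial(1)[OF mesh u that] polynomial_pderivative by (auto simp: pderivative_def[abs_def])
  have "ip (region M) (adv_h M u u) u =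
     (\<Sum>K\<in>elems M. (\<integral>x. indicator K x * ((\<Sum>j\<in>UNIV. (restr u K x $ j) *\<^sub>R pderivative j (restr u K) x) \<bullet> restr u K x) \<partial>lborel))"
    unfolding ip_def
  proof (rule integral_region[OF mesh])
    fix K assume K: "K \<in> elems M"
    show "AE x in lebesgue. x \<in> interior K \<longrightarrow> adv_h M u u x \<bullet> u x =
        (\<Sum>j\<in>UNIV. (restr u K x $ j) *\<^sub>R pderivative j (restr u K) x) \<bullet> restr u K x"
      using restr_polynomial(2)[OF mesh u K] 
      by eventually_elim (use elem_operators(2)[OF K] interior_subset[of K] in auto)
    show "continuous_on UNIV (\<lambda>x. (\<Sum>j\<in>UNIV. (restr u K x $ j) *\<^sub>R pderivative j (restr u K) x) \<bullet> restr u K x)"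
      by (intro continuous_intros continuous_on_polynomial pol K)
  qed
  moreover have "ip (region M) (\<lambda>x. div_h M u x *\<^sub>R u x) u =
     (\<Sum>K\<in>elems M. (\<integral>x. indicator K x * ((\<Sum>j\<in>UNIV. pderivative j (restr u K) x $ j) * (restr u K x \<bullet> restr u K x)) \<partial>lborel))"
    unfolding ip_def
  proof (rule integral_region[OF mesh])
    fix K assume K: "K \<in> elems M"
    show "AE x in lebesgue. x \<in> interior K \<longrightarrow> (div_h M u x *\<^sub>R u x) \<bullet> u x =
        (\<Sum>j\<in>UNIV. pderivative j (restr u K) x $ j) * (restr u K x \<bullet> restr u K x)"
      using restr_polynomial(2)[OF mesh u K] 
      by eventually_elim (use elem_operators(1)[OF K] interior_subset[of K] in auto)
    show "continuous_on UNIV (\<lambda>x. (\<Sum>j\<in>UNIV. pderivative j (restr u K) x $ j) * (restr u K x \<bullet> restr u K x))"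
      by (intro continuous_intros continuous_on_polynomial pol K)
  qed
  ultimately show ?thesis by (simp add: sum.distrib sum_distrib_left)
qed

text \<open>On interior faces the contributions of the elements cancel against the consistency terms, because of
the pointwise identity
\<open>(a \<bullet> n) \<bar>a\<bar>\<^sup>2 - (b \<bullet> n) \<bar>b\<bar>\<^sup>2 = 2 ({u} \<bullet> n) [u] \<bullet> {u} + ([u] \<bullet> n) {u \<bullet> u}\<close>
for the traces \<open>a\<close> and \<open>b\<close> of \<open>u\<close> from the two sides, where \<open>[u] = a - b\<close> and \<open>{u} = (a + b) / 2\<close>.
Only boundary faces remain.\<close>

lemma convective_bracket:
  "ip (region M) (adv_h M u u) u + 1/2 * ip (region M) (\<lambda>x. div_h M u x *\<^sub>R u x) u
    - ip_faces M (interior_faces M) (\<lambda>F x. (avg M u F x \<bullet> nrm M F) *\<^sub>R jump M u F x) (avg M u)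
    - 1/2 * ip_faces M (interior_faces M) (\<lambda>F x. jump M u F x \<bullet> nrm M F) (avg M (\<lambda>x. u x \<bullet> u x))
   = 1/2 * (\<Sum>F\<in>faces M - interior_faces M. LINT y:F|face_measure M F.
        (restr u (K_plus M F) y \<bullet> nrm M F) * (restr u (K_plus M F) y \<bullet> restr u (K_plus M F) y))"
proof -
  have "ip_faces M (interior_faces M) (\<lambda>F x. (avg M u F x \<bullet> nrm M F) *\<^sub>R jump M u F x) (avg M u)
    + 1/2 * ip_faces M (interior_faces M) (\<lambda>F x. jump M u F x \<bullet> nrm M F) (avg M (\<lambda>x. u x \<bullet> u x))
    = (\<Sum>F\<in>interior_faces M. 1/2 * (LINT y:F|face_measure M F.
        (restr u (K_plus M F) y \<bullet> nrm M F) * (restr u (K_plus M F) y \<bullet> restr u (K_plus M F) y)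
      - (restr u (K_minus M F) y \<bullet> nrm M F) * (restr u (K_minus M F) y \<bullet> restr u (K_minus M F) y)))"
    unfolding ip_faces_def sum_distrib_left sum.distrib[symmetric]
  proof (intro sum.cong refl)
    fix F assume F: "F \<in> interior_faces M"
    then have Ff: "F \<in> faces M" using interior_faces_subset by blast
    define a b n where "a = restr u (K_plus M F)" and "b = restr u (K_minus M F)" and "n = nrm M F"
    have ac: "continuous_on UNIV a" and bc: "continuous_on UNIV b" unfolding a_def b_def
      by (intro continuous_on_polynomial restr_polynomial[OF mesh u] K_plus[OF mesh Ff] K_minus[OF mesh F])+
    have avg: "avg M u F x = (1/2) *\<^sub>R (a x + b x)" "jump M u F x = a x - b x"
      "avg M (\<lambda>x. u x \<bullet> u x) F x = 1/2 * (a x \<bullet> a x + b x \<bullet> b x)" for x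
      using F restr_dot[OF mesh u K_plus(1)[OF mesh Ff]] restr_dot[OF mesh u K_minus(1)[OF mesh F]]
      by (auto simp: avg_def jump_def a_def b_def)
    define g1 where "g1 x = ((((1/2) *\<^sub>R (a x + b x)) \<bullet> n) *\<^sub>R (a x - b x)) \<bullet> ((1/2) *\<^sub>R (a x + b x))" for x
    define g2 where "g2 x = ((a x - b x) \<bullet> n) * (1/2 * (a x \<bullet> a x + b x \<bullet> b x))" for x
    have g: "set_integrable (face_measure M F) F g1" "set_integrable (face_measure M F) F g2"
      unfolding g1_def[abs_def] g2_def[abs_def] by (intro set_integrable_face Ff continuous_intros ac bc)+
    have "ipF M F (\<lambda>x. (avg M u F x \<bullet> nrm M F) *\<^sub>R jump M u F x) (avg M u F)
       + 1/2 * ipF M F (\<lambda>x. jump M u F x \<bullet> nrm M F) (avg M (\<lambda>x. u x \<bullet> u x) F)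
       = (LINT y:F|face_measure M F. g1 y) + (LINT y:F|face_measure M F. 1/2 * g2 y)"
      unfolding ipF_def avg n_def[symmetric] g1_def g2_def by simp
    also have "\<dots> = (LINT y:F|face_measure M F. g1 y + 1/2 * g2 y)"
      by (rule set_integral_add(2)[symmetric]) (use g in auto)
    also have "(\<lambda>y. g1 y + 1/2 * g2 y) = (\<lambda>y. 1/2 * ((a y \<bullet> n) * (a y \<bullet> a y) - (b y \<bullet> n) * (b y \<bullet> b y)))"
      by (auto simp: fun_eq_iff g1_def g2_def inner_add_left inner_add_right inner_diff_left inner_diff_right
          inner_commute field_simps)
    finally show "ipF M F (\<lambda>x. (avg M u F x \<bullet> nrm M F) *\<^sub>R jump M u F x) (avg M u F)
       + 1/2 * ipF M F (\<lambda>x. jump M u F x \<bullet> nrm M F) (avg M (\<lambda>x. u x \<bullet> u x) F)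
       = 1/2 * (LINT y:F|face_measure M F.
        (restr u (K_plus M F) y \<bullet> nrm M F) * (restr u (K_plus M F) y \<bullet> restr u (K_plus M F) y)
      - (restr u (K_minus M F) y \<bullet> nrm M F) * (restr u (K_minus M F) y \<bullet> restr u (K_minus M F) y))"
      unfolding a_def b_def n_def by simp
  qed
  then show ?thesis
    using volume_terms sum_element_energy by (simp add: sum_distrib_left)
qed

text \<open>At equal arguments both forms equal \<open>1 - \<theta>\<close> times the expression in \<open>convective_bracket\<close>, plus the
stabilization. The remaining boundary integrand \<open>(1 - \<theta>) / 2 (u \<bullet> n) \<bar>u\<bar>\<^sup>2\<close> has no sign, but it is
dominated by the stabilization \<open>\<zeta> \<bar>u \<bullet> n\<bar> \<bar>u\<bar>\<^sup>2\<close> where \<open>\<zeta>\<close> is large enough, and it vanishes where the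
normal component does. The two alternatives in the hypothesis serve the discontinuous and the
\<open>H(div)\<close> schemes.\<close>

lemma convective_energy:
  assumes c: "c_h \<in> {c1 M \<theta> \<zeta>, c2 M \<theta> \<zeta>}" and \<zeta>: "\<forall>F\<in>faces M. \<zeta> F \<ge> 0"
    and bd: "\<And>F. F \<in> boundary_faces M \<Longrightarrow> \<zeta> F \<ge> 1/2 * \<bar>1 - \<theta>\<bar> \<or> (\<forall>x\<in>F. restr u (K_plus M F) x \<bullet> nrm M F = 0)"
  shows "c_h u u \<ge> 0"
proof -
  define Z where "Z F = ipF M F (\<lambda>x. (\<zeta> F * \<bar>avg M u F x \<bullet> nrm M F\<bar>) *\<^sub>R jump M u F x) (jump M u F)" for F
  define G where "G F = (LINT y:F|face_measure M F.
        (restr u (K_plus M F) y \<bullet> nrm M F) * (restr u (K_plus M F) y \<bullet> restr u (K_plus M F) y))" for F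
  have "c_h u u = (1 - \<theta>) * (1/2 * (\<Sum>F\<in>faces M - interior_faces M. G F)) + (\<Sum>F\<in>faces M. Z F)"
    using c unfolding G_def convective_bracket[symmetric]
    by (auto simp: c1_def c2_def Z_def ip_faces_def algebra_simps add_divide_distrib diff_divide_distrib)
  also have "\<dots> = (\<Sum>F\<in>faces M - interior_faces M. (1 - \<theta>) / 2 * G F + Z F) + (\<Sum>F\<in>interior_faces M. Z F)"
    unfolding sum_faces_split[of Z] by (simp add: sum.distrib sum_distrib_left)
  also have "\<dots> \<ge> 0"
  proof (rule add_nonneg_nonneg[OF sum_nonneg sum_nonneg])
    fix F assume "F \<in> interior_faces M"
    then have "\<zeta> F \<ge> 0" using \<zeta> interior_faces_subset by blast
    then show "0 \<le> Z F"
      unfolding Z_def ipF_def set_lebesgue_integral_def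
      by (intro integral_nonneg_AE AE_I2) simp
  next
    fix F assume F: "F \<in> faces M - interior_faces M"
    define p where "p = restr u (K_plus M F)"
    have pc: "continuous_on UNIV p" unfolding p_def
      using F by (intro continuous_on_polynomial restr_polynomial[OF mesh u] K_plus[OF mesh]) auto
    have av: "avg M u F = p" "jump M u F = p" using F by (auto simp: avg_def jump_def p_def fun_eq_iff)
    define g where "g y = (p y \<bullet> nrm M F) * (p y \<bullet> p y)" for y
    define z where "z y = \<zeta> F * \<bar>p y \<bullet> nrm M F\<bar> * (p y \<bullet> p y)" for y
    have int: "set_integrable (face_measure M F) F g" "set_integrable (face_measure M F) F z"
      using F unfolding g_def[abs_def] z_def[abs_def] by (intro set_integrable_face continuous_intros pc; simp)+
    have "(1 - \<theta>) / 2 * G F + Z F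
        = (LINT y:F|face_measure M F. (1 - \<theta>) / 2 * g y) + (LINT y:F|face_measure M F. z y)"
      by (simp add: G_def Z_def ipF_def av g_def z_def p_def[symmetric])
    also have "\<dots> = (LINT y:F|face_measure M F. (1 - \<theta>) / 2 * g y + z y)"
      by (rule set_integral_add(2)[symmetric]) (use int in auto)
    also have "\<dots> \<ge> 0"
      unfolding set_lebesgue_integral_def
    proof (intro integral_nonneg_AE AE_I2)
      fix y
      have "0 \<le> (1 - \<theta>) / 2 * g y + z y" if y: "y \<in> F"
      proof -
        have "F \<in> boundary_faces M" using exterior_face_boundary[OF mesh, of F] F by simp
        from bd[OF this] show ?thesis
        proof
        assume "1/2 * \<bar>1 - \<theta>\<bar> \<le> \<zeta> F"
        then have "\<bar>(1 - \<theta>) / 2\<bar> * \<bar>p y \<bullet> nrm M F\<bar> * (p y \<bullet> p y) \<le> z y"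
          unfolding z_def by (intro mult_right_mono) auto
        moreover have "\<bar>(1 - \<theta>) / 2 * g y\<bar> = \<bar>(1 - \<theta>) / 2\<bar> * \<bar>p y \<bullet> nrm M F\<bar> * (p y \<bullet> p y)"
          by (simp add: g_def abs_mult)
        ultimately show ?thesis by linarith
      next
        assume "\<forall>x\<in>F. restr u (K_plus M F) x \<bullet> nrm M F = 0"
        then show ?thesis using y by (simp add: g_def z_def p_def)
        qed
      qed
      then show "0 \<le> indicator F y *\<^sub>R ((1 - \<theta>) / 2 * g y + z y)"
        by (simp add: indicator_def)
    qed
    finally show "0 \<le> (1 - \<theta>) / 2 * G F + Z F" .
  qed
  finally show ?thesis .
qed

end

end

section \<open>Decay of the energy along trajectories\<close>

lemma L2_integrable_dot:
  assumes f: "L2 \<Omega> f" and g: "L2 \<Omega> g"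
  shows "integrable (lebesgue_on \<Omega>) (\<lambda>x. f x \<bullet> g x)"
proof (rule Bochner_Integration.integrable_bound)
  have [measurable]: "f \<in> borel_measurable (lebesgue_on \<Omega>)" "g \<in> borel_measurable (lebesgue_on \<Omega>)"
    using f g by (auto simp: L2_def)
  show "integrable (lebesgue_on \<Omega>) (\<lambda>x. (norm (f x))\<^sup>2 + (norm (g x))\<^sup>2)"
    using f g by (auto simp: L2_def)
  show "(\<lambda>x. f x \<bullet> g x) \<in> borel_measurable (lebesgue_on \<Omega>)" by measurable
  show "AE x in lebesgue_on \<Omega>. norm (f x \<bullet> g x) \<le> norm ((norm (f x))\<^sup>2 + (norm (g x))\<^sup>2)"
  proof (intro AE_I2)
    fix x
    have "\<bar>f x \<bullet> g x\<bar> \<le> norm (f x) * norm (g x)" by (rule Cauchy_Schwarz_ineq2)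
    also have "\<dots> \<le> (norm (f x))\<^sup>2 + (norm (g x))\<^sup>2"
      using sum_squares_bound[of "norm (f x)" "norm (g x)"]
        mult_nonneg_nonneg[OF norm_ge_zero[of "f x"] norm_ge_zero[of "g x"]] by linarith
    finally show "norm (f x \<bullet> g x) \<le> norm ((norm (f x))\<^sup>2 + (norm (g x))\<^sup>2)" by simp
  qed
qed

lemma L2_add:
  assumes f: "L2 \<Omega> f" and g: "L2 \<Omega> g"
  shows "L2 \<Omega> (\<lambda>x. f x + g x)"
proof -
  have "f \<in> borel_measurable (lebesgue_on \<Omega>)" "g \<in> borel_measurable (lebesgue_on \<Omega>)"
    using f g by (auto simp: L2_def)
  then have "(\<lambda>x. f x + g x) \<in> borel_measurable (lebesgue_on \<Omega>)" by measurable
  moreover have "(norm (f x + g x))\<^sup>2 = f x \<bullet> f x + 2 * (f x \<bullet> g x) + g x \<bullet> g x" for x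
    by (simp add: power2_norm_eq_inner inner_add_left inner_add_right inner_commute)
  ultimately show ?thesis
    unfolding L2_def using L2_integrable_dot[OF f f] L2_integrable_dot[OF f g] L2_integrable_dot[OF g g] by simp
qed

lemma L2_scaleR: "L2 \<Omega> f \<Longrightarrow> L2 \<Omega> (\<lambda>x. c *\<^sub>R f x)"
  by (auto simp: L2_def power_mult_distrib)

lemma L2_diff: "L2 \<Omega> f \<Longrightarrow> L2 \<Omega> g \<Longrightarrow> L2 \<Omega> (\<lambda>x. f x - g x)"
  using L2_add[of \<Omega> f "\<lambda>x. (-1) *\<^sub>R g x"] L2_scaleR[of \<Omega> g "-1"] by simp

lemma ip_commute: "ip \<Omega> f g = ip \<Omega> g f"
  by (simp add: ip_def inner_commute)

lemma ip_add_left: "L2 \<Omega> f \<Longrightarrow> L2 \<Omega> g \<Longrightarrow> L2 \<Omega> h \<Longrightarrow> ip \<Omega> (\<lambda>x. f x + g x) h = ip \<Omega> f h + ip \<Omega> g h"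
  unfolding ip_def inner_add_left by (intro Bochner_Integration.integral_add L2_integrable_dot)

lemma ip_scaleR_left: "ip \<Omega> (\<lambda>x. c *\<^sub>R f x) g = c * ip \<Omega> f g"
  by (simp add: ip_def)

lemma ip_self_nonneg: "ip \<Omega> f f \<ge> 0"
  by (simp add: ip_def)

lemma L2norm_sq: "(L2norm \<Omega> f)\<^sup>2 = ip \<Omega> f f"
  by (simp add: L2norm_def ip_self_nonneg)

lemma ip_add_self:
  assumes "L2 \<Omega> f" "L2 \<Omega> g"
  shows "ip \<Omega> (\<lambda>x. f x + g x) (\<lambda>x. f x + g x) = ip \<Omega> f f + 2 * ip \<Omega> g f + ip \<Omega> g g"
  using ip_add_left[OF assms L2_add[OF assms]] ip_add_left[OF assms assms(1)] ip_add_left[OF assms assms(2)]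
    ip_commute[of \<Omega> f "\<lambda>x. f x + g x"] ip_commute[of \<Omega> g "\<lambda>x. f x + g x"] ip_commute[of \<Omega> f g]
  by simp

lemma ip_Cauchy_Schwarz:
  assumes f: "L2 \<Omega> f" and g: "L2 \<Omega> g"
  shows "\<bar>ip \<Omega> f g\<bar> \<le> L2norm \<Omega> f * L2norm \<Omega> g"
proof -
  \<comment> \<open>The usual discriminant argument for \<open>\<bar>f + s g\<bar>\<^sup>2 \<ge> 0\<close>,
    with \<open>s = - b / c\<close> the minimizer; for \<open>c = 0\<close>, the choice \<open>s = - (a + 1) /
    (2 b)\<close> gives the value \<open>-1\<close>.\<close>
  define a b c where "a = ip \<Omega> f f" and "b = ip \<Omega> f g" and "c = ip \<Omega> g g"
  have q: "0 \<le> a + 2 * (s * b) + s\<^sup>2 * c" for s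
    using ip_self_nonneg[of \<Omega> "\<lambda>x. f x + s *\<^sub>R g x"]
    unfolding ip_add_self[OF f L2_scaleR[OF g]] ip_scaleR_left a_def b_def c_def
      ip_commute[of \<Omega> g "\<lambda>x. s *\<^sub>R g x"] ip_commute[of \<Omega> g f]
    by (simp add: ip_commute[of \<Omega> g "\<lambda>x. s *\<^sub>R g x"] ip_scaleR_left power2_eq_square mult.assoc)
  have "b\<^sup>2 \<le> a * c"
  proof (cases "c = 0")
    case True
    have "b = 0"
    proof (rule ccontr)
      assume "b \<noteq> 0"
      then show False using q[of "- (a + 1) / (2 * b)"] True by (simp add: field_simps)
    qed
    then show ?thesis using True by simp
  next
    case False
    then have "c > 0" using ip_self_nonneg[of \<Omega> g] by (simp add: c_def)
    then have "a + 2 * (- b / c * b) + (- b / c)\<^sup>2 * c = (a * c - b\<^sup>2) / c"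
      by (simp add: field_simps power2_eq_square)
    then have "0 \<le> (a * c - b\<^sup>2) / c" using q[of "- b / c"] by simp
    then show ?thesis using \<open>c > 0\<close> by (simp add: zero_le_divide_iff)
  qed
  then have "sqrt (b\<^sup>2) \<le> sqrt (a * c)" by (rule real_sqrt_le_mono)
  then show ?thesis by (simp add: L2norm_def real_sqrt_mult a_def b_def c_def)
qed

text \<open>The squared norm has derivative \<open>2 (u', u)\<close>, as for any differentiable curve in an inner product
space. Trajectories are curves of functions rather than of classes modulo null sets, so \<^const>\<open>L2norm\<close> is
only a seminorm on them and the product rule is derived here from the Cauchy-Schwarz inequality.\<close>

lemma trajectory_energy_decreasing:
  assumes tr: "trajectory \<Omega> V T u u'" and V: "\<And>v. v \<in> V \<Longrightarrow> L2 \<Omega> v"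
    and diss: "\<And>t. t \<in> {0<..T} \<Longrightarrow> ip \<Omega> (u' t) (u t) \<le> 0"
    and t: "t \<in> {0..T}"
  shows "L2norm \<Omega> (u t) \<le> L2norm \<Omega> (u 0)"
proof -
  define N where "N s = ip \<Omega> (u s) (u s)" for s
  have uL: "L2 \<Omega> (u s)" if "s \<in> {0..T}" for s
    using tr V that by (auto simp: trajectory_def)
  have u'L: "L2 \<Omega> (u' s)" if "s \<in> {0<..T}" for s
    using tr V that by (auto simp: trajectory_def)
  have ev: "eventually (\<lambda>r. r \<in> {0..T} \<and> r \<noteq> s) (at s within {0..T})" for s
    by (simp add: eventually_at_filter)
  have cont: "continuous_on {0..T} N"
    unfolding continuous_on_def
  proof
    fix s assume s: "s \<in> {0..T}"
    define \<delta> where "\<delta> r = L2norm \<Omega> (\<lambda>x. u r x - u s x)" for r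
    have \<delta>: "(\<delta> \<longlongrightarrow> 0) (at s within {0..T})"
      using tr s by (auto simp: trajectory_def \<delta>_def[abs_def])
    have "((\<lambda>r. N r - N s) \<longlongrightarrow> 0) (at s within {0..T})"
    proof (rule Lim_null_comparison)
      show "eventually (\<lambda>r. norm (N r - N s) \<le> 2 * (\<delta> r * L2norm \<Omega> (u s)) + (\<delta> r)\<^sup>2) (at s within {0..T})"
        using ev
      proof eventually_elim
        case (elim r)
        have d: "L2 \<Omega> (\<lambda>x. u r x - u s x)" using elim s by (intro L2_diff uL) auto
        have "N r = ip \<Omega> (\<lambda>x. u s x + (u r x - u s x)) (\<lambda>x. u s x + (u r x - u s x))"
          by (simp add: N_def)
        also have "\<dots> = N s + 2 * ip \<Omega> (\<lambda>x. u r x - u s x) (u s) + (\<delta> r)\<^sup>2"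
          unfolding ip_add_self[OF uL[OF s] d] by (simp add: N_def \<delta>_def L2norm_sq)
        finally show ?case
          using ip_Cauchy_Schwarz[OF d uL[OF s]] unfolding \<delta>_def[symmetric]
          by (smt (verit) real_norm_def zero_le_power2)
      qed
      show "((\<lambda>r. 2 * (\<delta> r * L2norm \<Omega> (u s)) + (\<delta> r)\<^sup>2) \<longlongrightarrow> 0) (at s within {0..T})"
        using \<delta> by (auto intro!: tendsto_eq_intros)
    qed
    then show "(N \<longlongrightarrow> N s) (at s within {0..T})" by (simp add: LIM_zero_iff)
  qed
  have deriv: "(N has_real_derivative 2 * ip \<Omega> (u' s) (u s)) (at s)" if s: "0 < s" "s < T" for s
  proof -
    have s': "s \<in> {0..T}" "s \<in> {0<..T}" using s by auto
    define R where "R r x = (u r x - u s x) /\<^sub>R (r - s) - u' s x" for r x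
    define \<rho> where "\<rho> r = L2norm \<Omega> (R r)" for r
    have \<rho>: "(\<rho> \<longlongrightarrow> 0) (at s within {0..T})"
      using tr s' by (auto simp: trajectory_def \<rho>_def[abs_def] R_def[abs_def])
    define N' where "N' = ip \<Omega> (u' s) (u' s)"
    have "((\<lambda>r. (N r - N s) / (r - s) - 2 * ip \<Omega> (u' s) (u s)) \<longlongrightarrow> 0) (at s within {0..T})"
    proof (rule Lim_null_comparison)
      show "eventually (\<lambda>r. norm ((N r - N s) / (r - s) - 2 * ip \<Omega> (u' s) (u s))
         \<le> 2 * (\<rho> r * L2norm \<Omega> (u s)) + \<bar>r - s\<bar> * (N' + 2 * (\<rho> r * L2norm \<Omega> (u' s)) + (\<rho> r)\<^sup>2)) (at s within {0..T})"
        using ev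
      proof eventually_elim
        case (elim r)
        have rs: "r - s \<noteq> 0" using elim by simp
        have d: "L2 \<Omega> (R r)"
          unfolding R_def[abs_def] using elim s' by (intro L2_diff L2_scaleR uL u'L) auto
        define W where "W x = u' s x + R r x" for x
        have W: "L2 \<Omega> W" unfolding W_def[abs_def] using s' by (intro L2_add u'L d)
        have eq: "u r = (\<lambda>x. u s x + (r - s) *\<^sub>R W x)"
          using rs by (simp add: W_def R_def fun_eq_iff)
        have "N r = N s + 2 * ((r - s) * ip \<Omega> W (u s)) + (r - s) * ((r - s) * ip \<Omega> W W)"
          unfolding N_def eq ip_add_self[OF uL[OF s'(1)] L2_scaleR[OF W]]
          by (simp add: ip_scaleR_left ip_commute[of \<Omega> W "\<lambda>x. (r - s) *\<^sub>R W x"])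
        then have "(N r - N s) / (r - s) = 2 * ip \<Omega> W (u s) + (r - s) * ip \<Omega> W W"
          using rs by (simp add: divide_eq_eq) (simp add: algebra_simps)
        moreover have "ip \<Omega> W (u s) = ip \<Omega> (u' s) (u s) + ip \<Omega> (R r) (u s)"
          unfolding W_def[abs_def] using s' by (intro ip_add_left u'L uL d)
        moreover have "ip \<Omega> W W = N' + 2 * ip \<Omega> (R r) (u' s) + (\<rho> r)\<^sup>2"
          unfolding W_def[abs_def] ip_add_self[OF u'L[OF s'(2)] d] by (simp add: N'_def \<rho>_def L2norm_sq)
        ultimately have "(N r - N s) / (r - s) - 2 * ip \<Omega> (u' s) (u s) =
            2 * ip \<Omega> (R r) (u s) + (r - s) * (N' + 2 * ip \<Omega> (R r) (u' s) + (\<rho> r)\<^sup>2)" by simp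
        moreover have "\<bar>ip \<Omega> (R r) (u s)\<bar> \<le> \<rho> r * L2norm \<Omega> (u s)"
          unfolding \<rho>_def using d uL s' by (intro ip_Cauchy_Schwarz) auto
        moreover have "\<bar>(r - s) * (N' + 2 * ip \<Omega> (R r) (u' s) + (\<rho> r)\<^sup>2)\<bar>
            \<le> \<bar>r - s\<bar> * (N' + 2 * (\<rho> r * L2norm \<Omega> (u' s)) + (\<rho> r)\<^sup>2)"
        proof -
          have "\<bar>ip \<Omega> (R r) (u' s)\<bar> \<le> \<rho> r * L2norm \<Omega> (u' s)"
            unfolding \<rho>_def using d u'L s' by (intro ip_Cauchy_Schwarz) auto
          then have "\<bar>N' + 2 * ip \<Omega> (R r) (u' s) + (\<rho> r)\<^sup>2\<bar> \<le> N' + 2 * (\<rho> r * L2norm \<Omega> (u' s)) + (\<rho> r)\<^sup>2"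
            using ip_self_nonneg[of \<Omega> "u' s"] zero_le_power2[of "\<rho> r"] N'_def by linarith
          then show ?thesis unfolding abs_mult by (rule mult_left_mono) simp
        qed
        ultimately show ?case unfolding real_norm_def by linarith
      qed
      show "((\<lambda>r. 2 * (\<rho> r * L2norm \<Omega> (u s)) + \<bar>r - s\<bar> * (N' + 2 * (\<rho> r * L2norm \<Omega> (u' s)) + (\<rho> r)\<^sup>2)) \<longlongrightarrow> 0) (at s within {0..T})"
        using \<rho> by (auto intro!: tendsto_eq_intros)
    qed
    then have "((\<lambda>r. (N r - N s) / (r - s)) \<longlongrightarrow> 2 * ip \<Omega> (u' s) (u s)) (at s within {0..T})"
      by (simp add: LIM_zero_iff)
    then show ?thesis using s by (simp add: has_field_derivative_iff at_within_Icc_at)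
  qed
  have "N t \<le> N 0"
  proof (rule DERIV_nonpos_imp_decreasing_open[where f = N])
    show "0 \<le> t" using t by simp
    show "\<exists>y. (N has_real_derivative y) (at s) \<and> y \<le> 0" if "0 < s" "s < t" for s
      using deriv[of s] diss[of s] that t by auto
    show "continuous_on {0..t} N" using cont t by (auto intro: continuous_on_subset)
  qed
  then show ?thesis by (simp add: L2norm_def N_def)
qed

lemma d_h_self_nonneg:
  assumes mesh: "simplicial_mesh M" and "\<gamma> > 0"
  shows "d_h M \<gamma> u u \<ge> 0"
proof -
  have "0 \<le> inverse (diameter F)" if "F \<in> faces M" for F
    using compact_face[OF mesh that] by (simp add: compact_imp_bounded diameter_ge_0)
  moreover have "0 \<le> ipF M F g g" for F and g :: "real^'a \<Rightarrow> real"
    unfolding ipF_def set_lebesgue_integral_def by (intro integral_nonneg_AE AE_I2) simp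
  ultimately show ?thesis
    unfolding d_h_def using \<open>\<gamma> > 0\<close>
    by (intro mult_nonneg_nonneg add_nonneg_nonneg sum_nonneg ip_self_nonneg) auto
qed

section \<open>Stability of the semi-discrete schemes\<close>

theorem theorem1:
  fixes M :: "('n::finite) mesh"
    and k :: nat
    and \<kappa> \<theta> \<gamma> T :: real
    and \<zeta> :: "(real^'n) set \<Rightarrow> real"
    and c_h :: "(real^'n \<Rightarrow> real^'n) \<Rightarrow> (real^'n \<Rightarrow> real^'n) \<Rightarrow> real"
    and fam :: hdiv_family
  assumes "CARD('n) \<in> {2, 3}"
    and "simplicial_mesh M"
    and "shape_regular \<kappa> (elems M)"
    and "\<theta> \<in> {0, 1, -1}"
    and "\<gamma> > 0"
    and "T > 0"
    and "\<forall>F\<in>faces M. \<zeta> F \<ge> 0"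
    and "c_h \<in> {c1 M \<theta> \<zeta>, c2 M \<theta> \<zeta>}"
  shows "((\<forall>F\<in>boundary_faces M. \<zeta> F \<ge> 1/2 * \<bar>1 - \<theta>\<bar>) \<longrightarrow>
          (\<forall>u u' P.
             trajectory (region M) (V_h M k) T u u' \<and>
             (\<forall>t\<in>{0<..T}. P t \<in> Q_h M k \<and>
                (\<forall>v\<in>V_h M k. ip (region M) (u' t) v + c_h (u t) v - b_h M v (P t)
                                + d_h M \<gamma> (u t) v = 0) \<and>
                (\<forall>q\<in>Q_h M k. b_h M (u t) q = 0)) \<longrightarrow>
             (\<forall>t\<in>{0..T}. L2norm (region M) (u t) \<le> L2norm (region M) (u 0))))
       \<and> (\<forall>u u' P.
             trajectory (region M) (V_div M fam k) T u u' \<and>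
             (\<forall>t\<in>{0<..T}. P t \<in> Q_h M k \<and>
                (\<forall>v\<in>V_div M fam k. ip (region M) (u' t) v + c_h (u t) v
                                - ip (region M) (weak_div (region M) v) (P t) = 0) \<and>
                (\<forall>q\<in>Q_h M k. ip (region M) (weak_div (region M) (u t)) q = 0)) \<longrightarrow>
             (\<forall>t\<in>{0..T}. L2norm (region M) (u t) \<le> L2norm (region M) (u 0)))"
proof (intro conjI impI allI ballI; elim conjE)
  fix u u' P t
  assume \<zeta>: "\<forall>F\<in>boundary_faces M. \<zeta> F \<ge> 1/2 * \<bar>1 - \<theta>\<bar>"
    and tr: "trajectory (region M) (V_h M k) T u u'"
    and eq: "\<forall>t\<in>{0<..T}. P t \<in> Q_h M k \<and>
                (\<forall>v\<in>V_h M k. ip (region M) (u' t) v + c_h (u t) v - b_h M v (P t)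
                                + d_h M \<gamma> (u t) v = 0) \<and>
                (\<forall>q\<in>Q_h M k. b_h M (u t) q = 0)"
    and t: "t \<in> {0..T}"
  show "L2norm (region M) (u t) \<le> L2norm (region M) (u 0)"
  proof (rule trajectory_energy_decreasing[OF tr _ _ t])
    show "L2 (region M) v" if "v \<in> V_h M k" for v using that by (simp add: V_h_def)
    fix s assume s: "s \<in> {0<..T}"
    then have V: "u s \<in> V_h M k" using tr by (auto simp: trajectory_def)
    have "c_h (u s) (u s) \<ge> 0"
      using convective_energy[OF assms(2) V_h_piecewise_polynomial[OF V] assms(8,7)] \<zeta> by blast
    moreover have "b_h M (u s) (P s) = 0" using eq s by blast
    moreover have "ip (region M) (u' s) (u s) + c_h (u s) (u s) - b_h M (u s) (P s) + d_h M \<gamma> (u s) (u s) = 0"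
      using eq s V by blast
    ultimately show "ip (region M) (u' s) (u s) \<le> 0"
      using d_h_self_nonneg[OF assms(2,5), of "u s"] by linarith
  qed
next
  fix u u' P t
  assume tr: "trajectory (region M) (V_div M fam k) T u u'"
    and eq: "\<forall>t\<in>{0<..T}. P t \<in> Q_h M k \<and>
                (\<forall>v\<in>V_div M fam k. ip (region M) (u' t) v + c_h (u t) v
                                - ip (region M) (weak_div (region M) v) (P t) = 0) \<and>
                (\<forall>q\<in>Q_h M k. ip (region M) (weak_div (region M) (u t)) q = 0)"
    and t: "t \<in> {0..T}"
  show "L2norm (region M) (u t) \<le> L2norm (region M) (u 0)"
  proof (rule trajectory_energy_decreasing[OF tr _ _ t])
    show "L2 (region M) v" if "v \<in> V_div M fam k" for v using that by (simp add: V_div_def Hdiv_def)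
    fix s assume s: "s \<in> {0<..T}"
    then have V: "u s \<in> V_div M fam k" using tr by (auto simp: trajectory_def)
    then have "\<forall>x\<in>F. restr (u s) (K_plus M F) x \<bullet> nrm M F = 0" if "F \<in> boundary_faces M" for F
      using that by (simp add: V_div_def)
    then have "c_h (u s) (u s) \<ge> 0"
      using convective_energy[OF assms(2) V_div_piecewise_polynomial[OF V] assms(8,7)] by blast
    moreover have "ip (region M) (weak_div (region M) (u s)) (P s) = 0" using eq s by blast
    moreover have "ip (region M) (u' s) (u s) + c_h (u s) (u s)
        - ip (region M) (weak_div (region M) (u s)) (P s) = 0"
      using eq s V by blast
    ultimately show "ip (region M) (u' s) (u s) \<le> 0" by linarith
  qed
qed

end
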